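(* For every positive integer $N$, \[ \sum_{\substack{\pi\in\tilde{C}\\ |\pi|=N}} 2^{\nu_d(\pi)} \;=\; \sum_{\substack{\pi\in\mathcal{R}\\ |\pi|=N}} \mu(\pi) \;=\; \sum_{\substack{\pi\in\mathcal{Q}\\ |\pi|=N}} \eta(\pi). \]
   Context: A partition is a finite non-increasing sequence of positive integers (its parts); $|\pi|$ is the sum of its parts, $\nu_d(\pi)$ the number of distinct part sizes, $\nu_{d,e}(\pi)$ the number of distinct even part sizes, and $f_i=f_i(\pi)$ the number of times $i$ occurs as a part (possibly $0$). $\chi(S)$ is $1$ if the statement $S$ is true and $0$ otherwise. $\tilde{C}$ is the set of non-empty partitions with no part divisible by $3$. $\mathcal{R}$ is the set of partitions $\pi$ for which there is an integer $n>0$ such that: (i) all parts are $\le 2n-1$; (ii) every even integer $\le 2n-2$ is a part; (iii) $f_n\ge 1+\chi(n \text{ is even})$; (iv) no even part larger than $n$ occurs more than once; such $n=n(\pi)$ is unique (it is $1$ plus half the largest even part, or $1$ if there is no even part). For $\pi\in\mathcal{R}$ with $n=n(\pi)$: $\mu(\pi)=2^{\delta(\pi)}\big(\chi(n\text{ even})+2f_n\chi(n\text{ odd})\big)\prod_{j\ge0,\,2j+1<n}(2f_{2j+1}+1)$ where $\delta(\pi)=\sum_{j=1}^{n-1}\chi(f_{2j}>1)$. $\mathcal{Q}$ is the set of partitions $\pi$ for which there is an integer $n>0$ such that: (i) the largest part is $2n-1$; (ii) every odd integer $\le 2n-1$ is a part; (iii) no even part larger than $n$ occurs; here $n=n(\pi)=(\text{largest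 part}+1)/2$. For $\pi\in\mathcal{Q}$ with $n=n(\pi)$: $\eta(\pi)=2^{\nu_{d,e}(\pi)}\big(\chi(n\text{ even})(1+\chi(f_n=0))+2f_n\chi(n\text{ odd})\big)\prod_{j\ge0,\,2j+1<n}(2f_{2j+1}-1)$. *)

theory Defs
  imports Main
begin

definition is_partition :: "nat list \<Rightarrow> bool" where
  "is_partition p \<longleftrightarrow> sorted_wrt (\<ge>) p \<and> (\<forall>i\<in>set p. 0 < i)"

abbreviation psize :: "nat list \<Rightarrow> nat" where
  "psize p \<equiv> sum_list p"

abbreviation freq :: "nat list \<Rightarrow> nat \<Rightarrow> nat" where
  "freq p i \<equiv> count_list p i"

definition nu_d :: "nat list \<Rightarrow> nat" where
  "nu_d p = card (set p)"

definition nu_de :: "nat list \<Rightarrow> nat" where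
  "nu_de p = card {i \<in> set p. even i}"

text \<open>The sums in the theorem range over finite sets, so none of them is zero by the
  convention for infinite index sets.\<close>

lemma finite_partitions: "finite {p. is_partition p \<and> psize p = N}"
proof -
  have len: "length p \<le> sum_list p" if "\<forall>i\<in>set p. 0 < i" for p :: "nat list"
    using that by (induction p) auto
  have "{p. is_partition p \<and> psize p = N} \<subseteq> {p. set p \<subseteq> {..N} \<and> length p \<le> N}"
    using len member_le_sum_list by (auto simp: is_partition_def)
  moreover have "finite {p. set p \<subseteq> {..N} \<and> length p \<le> N}"
    by (rule finite_lists_length_le) simp
  ultimately show ?thesis by (rule finite_subset)
qed

definition Ctilde :: "nat list set" where
  "Ctilde = {p. is_partition p \<and> p \<noteq> [] \<and> (\<forall>i\<in>set p. \<not> 3 dvd i)}"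

text \<open>The guard \<open>0 < i\<close> is needed since \<open>0\<close> is even but never a part. Since \<open>0 < n\<close>,
  the natural-number subtractions are exact.\<close>

definition R_index :: "nat list \<Rightarrow> nat \<Rightarrow> bool" where
  "R_index p n \<longleftrightarrow> 0 < n
     \<and> (\<forall>i\<in>set p. i \<le> 2 * n - 1)
     \<and> (\<forall>i. 0 < i \<and> even i \<and> i \<le> 2 * n - 2 \<longrightarrow> i \<in> set p)
     \<and> freq p n \<ge> 1 + of_bool (even n)
     \<and> (\<forall>i. even i \<and> n < i \<longrightarrow> freq p i \<le> 1)"

definition R_set :: "nat list set" where
  "R_set = {p. is_partition p \<and> (\<exists>n. R_index p n)}"

lemma R_index_unique:
  assumes "R_index p m" "R_index p n"
  shows "m = n"
proof -
  have False if "R_index p a" "R_index p b" "a < b" for a b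
  proof -
    have "2 * b - 2 \<in> set p" "2 * b - 2 \<le> 2 * a - 1" "0 < a"
      using that unfolding R_index_def by auto
    with \<open>a < b\<close> show False by arith
  qed
  with assms show ?thesis by (meson linorder_neqE_nat)
qed

definition R_n :: "nat list \<Rightarrow> nat" where
  "R_n p = (THE n. R_index p n)"

definition delta :: "nat list \<Rightarrow> nat" where
  "delta p = (\<Sum>j = 1..R_n p - 1. of_bool (freq p (2 * j) > 1))"

text \<open>The weights are integers so that \<open>2 * f - 1\<close> below is a genuine subtraction.\<close>

definition mu :: "nat list \<Rightarrow> int" where
  "mu p = (let n = R_n p in
     2 ^ delta p * (of_bool (even n) + 2 * int (freq p n) * of_bool (odd n))
       * (\<Prod>j | 2 * j + 1 < n. 2 * int (freq p (2 * j + 1)) + 1))"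

definition Q_index :: "nat list \<Rightarrow> nat \<Rightarrow> bool" where
  "Q_index p n \<longleftrightarrow> 0 < n
     \<and> p \<noteq> [] \<and> Max (set p) = 2 * n - 1
     \<and> (\<forall>i. odd i \<and> i \<le> 2 * n - 1 \<longrightarrow> i \<in> set p)
     \<and> (\<forall>i\<in>set p. even i \<longrightarrow> i \<le> n)"

definition Q_set :: "nat list set" where
  "Q_set = {p. is_partition p \<and> (\<exists>n. Q_index p n)}"

definition Q_n :: "nat list \<Rightarrow> nat" where
  "Q_n p = (Max (set p) + 1) div 2"

lemma Q_index_Q_n: "Q_index p n \<Longrightarrow> n = Q_n p"
  by (auto simp: Q_index_def Q_n_def)

definition eta :: "nat list \<Rightarrow> int" where
  "eta p = (let n = Q_n p in
     2 ^ nu_de p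
       * (of_bool (even n) * (1 + of_bool (freq p n = 0)) + 2 * int (freq p n) * of_bool (odd n))
       * (\<Prod>j | 2 * j + 1 < n. 2 * int (freq p (2 * j + 1)) - 1))"

end

theory Submission
  imports Defs "HOL-Computational_Algebra.Formal_Power_Series"
begin

text \<open>For fixed $n$, the weights of $R$ and of $Q$ are products over the part sizes, and after
  multiplying the resulting local factors both generating functions become
  $T_n = q^{n^2} (-1;q)_n (-q;q)_n / (q;q)_{2n}$. So both identities reduce to Slater's
  $$\sum_{n \ge 0} T_n = \prod_{3 \nmid i} \frac{1 + q^i}{1 - q^i},$$
  which comes from Bailey's lemma: the finite Jacobi triple product expands
  $(-1;q)_n (-q;q)_n$ into $q$-binomial coefficients, the $q$-Vandermonde sum performs the
  summation over $n$, and the remaining theta series is the Jacobi triple product in base $q^3$.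
  Every identity is used in its finite form, modulo $q^{M+1}$ in the ring of formal power series,
  so that no infinite product or limit is needed.\<close>

subsection \<open>Gaussian binomials and the finite Jacobi triple product\<close>

text \<open>The modulus 3 enters through an exponent: Bailey's lemma multiplies the theta terms of
  base q by q^(s^2), and s^2 + s(s-1)/2 = 3 s(s-1)/2 + s is the quadratic form of base q^3. The
  power q^(n^2) in T_n is the size of the smallest partition with index n: 1 + 3 + ... + (2n-1) for
  Q, and 2 + 4 + ... + (2n-2) plus one further n for R. A class of partitions becomes a product
  because each of its conditions concerns the multiplicity of a single part size, and a local weight
  that vanishes at the forbidden multiplicities encodes it. The term T_0 = 1 belongs to no index and
  accounts for the empty partition. Truncation is delicate, since factors such as 1/(q;q)_(M-s)
  agree with their limit to low order only; what saves the argument is that the s-th term is itself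
  divisible by q^s.\<close>

definition qpoch :: "'a::comm_ring_1 \<Rightarrow> 'a \<Rightarrow> nat \<Rightarrow> 'a" where
  "qpoch a q n = (\<Prod>i<n. 1 - a * q ^ i)"

lemma qpoch_0 [simp]: "qpoch a q 0 = 1"
  by (simp add: qpoch_def)

lemma qpoch_Suc: "qpoch a q (Suc n) = qpoch a q n * (1 - a * q ^ n)"
  by (simp add: qpoch_def)

text \<open>The q-Pascal rule is the definition because quotients of Pochhammer products need not
  exist in a commutative ring.\<close>

fun qbinom :: "'a::comm_ring_1 \<Rightarrow> nat \<Rightarrow> nat \<Rightarrow> 'a" where
  "qbinom q n 0 = 1"
| "qbinom q 0 (Suc k) = 0"
| "qbinom q (Suc n) (Suc k) = qbinom q n k + q ^ Suc k * qbinom q n (Suc k)"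

lemma qbinom_eq_0: "n < k \<Longrightarrow> qbinom q n k = 0"
  by (induction q n k rule: qbinom.induct) auto

lemma qbinom_self [simp]: "qbinom q n n = 1"
  by (induction n) (auto simp: qbinom_eq_0)

text \<open>In the Pascal step the two summands acquire the factors 1 - q^k and q^k (1 - q^m), whose
  sum 1 - q^(k+m) is the last factor of the larger product.\<close>

lemma qbinom_qpoch: "qbinom q (k + m) k * (qpoch q q k * qpoch q q m) = qpoch q q (k + m)"
proof (induction "k + m" arbitrary: k m)
  case 0
  then show ?case by simp
next
  case (Suc n)
  show ?case
  proof (cases "k = 0 \<or> m = 0")
    case True
    then show ?thesis by auto
  next
    case False
    then obtain j l where k: "k = Suc j" and m: "m = Suc l"
      by (metis not0_implies_Suc)
    have n: "n = j + Suc l" "n = Suc j + l"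
      using Suc.hyps(2) k m by auto
    have 1: "qbinom q n j * (qpoch q q j * qpoch q q (Suc l)) = qpoch q q n"
      using Suc.hyps(1)[of j "Suc l"] n by simp
    have 2: "qbinom q n (Suc j) * (qpoch q q (Suc j) * qpoch q q l) = qpoch q q n"
      using Suc.hyps(1)[of "Suc j" l] n by simp
    have "qbinom q (k + m) k * (qpoch q q k * qpoch q q m)
        = (1 - q ^ Suc j) * (qbinom q n j * (qpoch q q j * qpoch q q (Suc l)))
          + q ^ Suc j * (1 - q ^ Suc l) * (qbinom q n (Suc j) * (qpoch q q (Suc j) * qpoch q q l))"
      using n by (simp add: k m qpoch_Suc algebra_simps)
    also have "\<dots> = (1 - q ^ Suc j * q ^ Suc l) * qpoch q q n"
      unfolding 1 2 by (simp add: algebra_simps)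
    also have "\<dots> = qpoch q q (k + m)"
      using n by (simp add: k m qpoch_Suc power_add algebra_simps)
    finally show ?thesis .
  qed
qed

text \<open>The dual Pascal rule. Pochhammer products cannot be cancelled in a general ring, so both
  terms of the defining rule are expanded by induction and regrouped. Where n - k is truncated, the
  coefficient beside it is zero.\<close>

lemma qbinom_Suc_Suc': "qbinom q (Suc n) (Suc k) = q ^ (n - k) * qbinom q n k + qbinom q n (Suc k)"
proof (induction n arbitrary: k)
  case 0
  then show ?case by (cases k) auto
next
  case (Suc n)
  show ?case
  proof (cases "k \<le> n")
    case False
    then have "k = Suc n \<or> Suc n < k" by auto
    then show ?thesis by (auto simp: qbinom_eq_0)
  next
    case True
    show ?thesis
    proof (cases k)
      case 0
      have "qbinom q (Suc (Suc n)) (Suc 0) = 1 + q * qbinom q (Suc n) (Suc 0)"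
        by simp
      also have "\<dots> = 1 + q * (q ^ n + qbinom q n (Suc 0))"
        using Suc.IH [of 0] by (simp del: qbinom.simps(3))
      finally show ?thesis
        by (simp add: 0 algebra_simps)
    next
      case k: (Suc j)
      have e: "Suc n - k = Suc (n - k)" "n - j = Suc (n - k)"
        using True k by auto
      have pw: "q ^ Suc k * q ^ (n - k) = q ^ Suc n"
        using True by (simp flip: power_add del: power_Suc)
      have pw': "q ^ (Suc n - k) * q ^ k = q ^ Suc n"
        using True by (simp flip: power_add)
      have "qbinom q (Suc (Suc n)) (Suc k)
          = qbinom q (Suc n) k + q ^ Suc k * qbinom q (Suc n) (Suc k)"
        by (rule qbinom.simps(3))
      also have "qbinom q (Suc n) k = q ^ (Suc n - k) * qbinom q n j + qbinom q n k"
        using Suc.IH [of j] e by (simp add: k del: qbinom.simps(3))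
      also have "qbinom q (Suc n) (Suc k) = q ^ (n - k) * qbinom q n k + qbinom q n (Suc k)"
        by (rule Suc.IH)
      also have "q ^ (Suc n - k) * qbinom q n j + qbinom q n k
            + q ^ Suc k * (q ^ (n - k) * qbinom q n k + qbinom q n (Suc k))
          = q ^ (Suc n - k) * (qbinom q n j + q ^ k * qbinom q n k)
            + (qbinom q n k + q ^ Suc k * qbinom q n (Suc k))"
        using pw pw' by (simp add: distrib_left mult.assoc [symmetric] del: power_Suc)
      finally show ?thesis
        by (simp add: k)
    qed
  qed
qed

lemma qbinom_symmetric: "qbinom q (k + m) k = qbinom q (k + m) m"
proof (induction "k + m" arbitrary: k m)
  case 0
  then show ?case by simp
next
  case (Suc n)
  show ?case
  proof (cases "k = 0 \<or> m = 0")
    case True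
    then show ?thesis by auto
  next
    case False
    then obtain j l where k: "k = Suc j" and m: "m = Suc l"
      by (metis not0_implies_Suc)
    have n: "k + m = Suc n" "n = j + Suc l" "n = Suc j + l" "n - l = Suc j"
      using Suc.hyps(2) k m by auto
    have "qbinom q n j = qbinom q n (Suc l)" "qbinom q n (Suc j) = qbinom q n l"
      using Suc.hyps(1)[of j "Suc l"] Suc.hyps(1)[of "Suc j" l] n by simp_all
    then show ?thesis
      using qbinom_Suc_Suc' [of q n l] n by (simp add: k m)
  qed
qed

text \<open>One Pascal rule of each kind, composed. It passes from row 2M to row 2M + 2, which is
  the step from M to M + 1 in the triple product.\<close>

lemma qbinom_Suc_Suc_Suc:
  "qbinom q (Suc (Suc n)) (Suc (Suc k)) = q ^ (n - k) * qbinom q n k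
     + (1 + q ^ Suc n) * qbinom q n (Suc k) + q ^ Suc (Suc k) * qbinom q n (Suc (Suc k))"
proof -
  have "q ^ Suc (Suc k) * (q ^ (n - Suc k) * qbinom q n (Suc k)) = q ^ Suc n * qbinom q n (Suc k)"
  proof (cases "Suc k \<le> n")
    case True
    then have "q ^ Suc (Suc k) * q ^ (n - Suc k) = q ^ Suc n"
      by (simp flip: power_add power_Suc)
    then show ?thesis
      by (simp only: mult.assoc [symmetric])
  qed (simp add: qbinom_eq_0)
  then show ?thesis
    unfolding qbinom.simps(3)[of q "Suc n"] qbinom_Suc_Suc' [of q n]
    by (simp only: distrib_left distrib_right mult_1 add.assoc)
qed

text \<open>The neighbours M - 1 and M + 1 of the centre of row 2M coincide by symmetry, hence the
  factor 2.\<close>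

lemma qbinom_middle:
  "qbinom q (2 * Suc M) (Suc M)
     = (1 + q ^ Suc (2 * M)) * qbinom q (2 * M) M + 2 * q ^ Suc M * qbinom q (2 * M) (Suc M)"
proof (cases M)
  case (Suc L)
  have "qbinom q (2 * M) L = qbinom q (2 * M) (Suc M)"
    using qbinom_symmetric [of q L "Suc M"] Suc by (simp add: mult_2 del: qbinom.simps)
  moreover have "2 * M - L = Suc M"
    using Suc by simp
  ultimately show ?thesis
    using qbinom_Suc_Suc_Suc [of q "2 * M" L] Suc
    by (simp add: algebra_simps del: qbinom.simps power_Suc)
qed (simp add: numeral_2_eq_2)

text \<open>The exponents $r$ and $-r$ of the bilateral theta series are merged into one term.\<close>

definition theta_term :: "'a::comm_ring_1 \<Rightarrow> 'a \<Rightarrow> nat \<Rightarrow> 'a" where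
  "theta_term z u s = (if s = 0 then 1 else (z * u) ^ (s choose 2) * (z ^ s + u ^ s))"

text \<open>From (z + u)(z^s + u^s) = z^(s+1) + u^(s+1) + z u (z^(s-1) + u^(s-1)). Merging r with -r
  creates the boundary cases: s = 0 has no lower neighbour, and at s = 1 the sum z^0 + u^0 is 2
  whereas the term of index 0 is 1.\<close>

lemma theta_term_recurrence:
  fixes z u :: "'a::comm_ring_1"
  defines "p \<equiv> z * u"
  assumes "s \<le> M"
  shows "p ^ M * (z + u) * theta_term z u s
    = theta_term z u (Suc s) * p ^ (M - s)
      + (if s = 0 then 0 else if s = 1 then 2 * p ^ Suc M else theta_term z u (s - 1) * p ^ (M + s))"
proof -
  obtain L where M: "M = L + s"
    using assms(2) by (metis le_iff_add add.commute)
  consider "s = 0" | "s = 1" | t where "s = Suc (Suc t)"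
    by (metis One_nat_def not0_implies_Suc)
  then show ?thesis
  proof cases
    case 3
    have [simp]: "Suc n choose 2 = n + (n choose 2)" for n
      by (simp add: numeral_2_eq_2)
    show ?thesis
      by (simp add: 3 M theta_term_def p_def power_add algebra_simps power_mult_distrib)
  qed (simp_all add: M theta_term_def p_def numeral_2_eq_2 algebra_simps)
qed

text \<open>With z * u as base, u stands for q/z and no negative power of z occurs. Passing to M + 1
  multiplies by (1 + p^(2M+1)) + p^M (z + u) for p = z u: the first summand keeps s, the second
  moves it by one in either direction, as in the two-step Pascal rule.\<close>

lemma finite_Jacobi_triple_product:
  "(\<Prod>i<M. (1 + z * (z * u) ^ i) * (1 + u * (z * u) ^ i))
     = (\<Sum>s\<le>M. theta_term z u s * qbinom (z * u) (2 * M) (M + s))"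
proof (induction M)
  case 0
  show ?case by (simp add: theta_term_def)
next
  case (Suc M)
  define p where "p = z * u"
  define a where "a = theta_term z u"
  define B where "B s = qbinom p (2 * M) (M + s)" for s
  define B' where "B' s = qbinom p (2 * Suc M) (Suc M + s)" for s
  \<comment> \<open>The part of the recurrence that lowers s; its value at s = 1 yields the doubled
    neighbour in \<open>B'_0\<close>.\<close>
  define c where "c s = (if s = 0 then 0 else if s = 1 then 2 * p ^ Suc M
     else a (s - 1) * p ^ (M + s))" for s
  have a0: "a 0 = 1"
    by (simp add: a_def theta_term_def)
  have B0: "B s = 0" if "M < s" for s
    using that by (simp add: B_def qbinom_eq_0)
  have B'_0: "B' 0 = (1 + p ^ Suc (2 * M)) * B 0 + 2 * p ^ Suc M * B 1"
    using qbinom_middle [of p M] by (simp add: B_def B'_def del: qbinom.simps power_Suc mult_Suc_right)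
  have B'_Suc: "B' (Suc s) = p ^ (M - s) * B s + (1 + p ^ Suc (2 * M)) * B (Suc s)
      + p ^ (M + s + 2) * B (s + 2)" for s
    using qbinom_Suc_Suc_Suc [of p "2 * M" "M + s"]
    by (simp add: B_def B'_def del: qbinom.simps power_Suc)
  have step: "p ^ M * (z + u) * a s = a (Suc s) * p ^ (M - s) + c s" if "s \<le> M" for s
    using theta_term_recurrence [OF that, of z u] by (simp add: a_def c_def p_def)
  have top: "(\<Sum>s\<le>M. a s * B s) = B 0 + (\<Sum>s\<le>M. a (Suc s) * B (Suc s))"
  proof -
    have "(\<Sum>s\<le>M. a s * B s) = (\<Sum>s\<le>Suc M. a s * B s)"
      by (simp add: B0)
    then show ?thesis
      by (simp add: sum.atMost_Suc_shift a0 del: sum.atMost_Suc)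
  qed
  have c: "(\<Sum>s\<le>M. c s * B s) = 2 * p ^ Suc M * B 1 + (\<Sum>s\<le>M. a (Suc s) * p ^ (M + s + 2) * B (s + 2))"
  proof -
    have "(\<Sum>s\<le>M. c s * B s) = (\<Sum>s\<le>Suc (Suc M). c s * B s)"
      by (simp add: B0)
    also have "\<dots> = c 0 * B 0 + (c 1 * B 1 + (\<Sum>s\<le>M. c (Suc (Suc s)) * B (Suc (Suc s))))"
      by (simp only: sum.atMost_Suc_shift One_nat_def)
    also have "\<dots> = 2 * p ^ Suc M * B 1 + (\<Sum>s\<le>M. a (Suc s) * p ^ (M + s + 2) * B (s + 2))"
      by (simp add: c_def)
    finally show ?thesis .
  qed
  have "(\<Prod>i<Suc M. (1 + z * (z * u) ^ i) * (1 + u * (z * u) ^ i))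
      = (\<Sum>s\<le>M. a s * B s) * ((1 + z * p ^ M) * (1 + u * p ^ M))"
    using Suc.IH by (simp add: a_def B_def p_def)
  also have "(1 + z * p ^ M) * (1 + u * p ^ M) = (1 + p ^ Suc (2 * M)) + p ^ M * (z + u)"
    by (simp add: algebra_simps mult_2 mult_2_right power_add p_def)
  also have "(\<Sum>s\<le>M. a s * B s) * \<dots>
      = (1 + p ^ Suc (2 * M)) * (\<Sum>s\<le>M. a s * B s) + (\<Sum>s\<le>M. p ^ M * (z + u) * a s * B s)"
    by (simp add: sum_distrib_left distrib_left mult.commute mult.left_commute del: power_Suc)
  also have "(\<Sum>s\<le>M. p ^ M * (z + u) * a s * B s)
      = (\<Sum>s\<le>M. a (Suc s) * p ^ (M - s) * B s) + (\<Sum>s\<le>M. c s * B s)"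
    using step by (simp add: distrib_right flip: sum.distrib)
  also have "(1 + p ^ Suc (2 * M)) * (\<Sum>s\<le>M. a s * B s) + \<dots>
      = a 0 * B' 0 + (\<Sum>s\<le>M. a (Suc s) * B' (Suc s))"
    unfolding top c B'_0 B'_Suc a0
    by (simp add: sum.distrib sum_distrib_left algebra_simps del: power_Suc)
  also have "\<dots> = (\<Sum>s\<le>Suc M. a s * B' s)"
    by (simp only: sum.atMost_Suc_shift)
  finally show ?case
    by (simp only: a_def B'_def p_def)
qed

section \<open>The q-Vandermonde sum\<close>

text \<open>\<open>D\<close> abstracts 1/(q;q)_m through its recurrence, so that no division occurs.
  After the Pascal rule on L, D(m+s) = D(m+s+1) - q^(m+s+1) D(m+s+1) produces a term that cancels
  \<open>f m\<close>; what remains is the induction hypothesis at s + 1.\<close>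

lemma q_Vandermonde:
  fixes q :: "'a::comm_ring_1"
  assumes D: "\<And>m. D m = (1 - q ^ Suc m) * D (Suc m)"
  shows "(\<Sum>m\<le>L. q ^ (m * (m + s)) * qbinom q L m * D (m + s)) = D (L + s)"
proof (induction L arbitrary: s)
  case 0
  then show ?case by simp
next
  case (Suc L)
  define f where "f m = q ^ (Suc m * (Suc m + s)) * qbinom q L m * D (Suc m + s)" for m
  have "(\<Sum>m\<le>Suc L. q ^ (m * (m + s)) * qbinom q (Suc L) m * D (m + s))
      = D s + (\<Sum>m\<le>L. q ^ (Suc m * (Suc m + s)) * qbinom q (Suc L) (Suc m) * D (Suc m + s))"
    by (simp add: sum.atMost_Suc_shift del: sum.atMost_Suc qbinom.simps(3))
  also have "\<dots> = (\<Sum>m\<le>L. f m)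
      + (D s + (\<Sum>m\<le>L. q ^ (Suc m * (Suc m + s)) * q ^ Suc m * qbinom q L (Suc m) * D (Suc m + s)))"
    by (simp add: f_def sum.distrib algebra_simps)
  also have "D s + (\<Sum>m\<le>L. q ^ (Suc m * (Suc m + s)) * q ^ Suc m * qbinom q L (Suc m) * D (Suc m + s))
      = (\<Sum>m\<le>Suc L. q ^ (m * (m + s)) * q ^ m * qbinom q L m * D (m + s))"
    by (simp add: sum.atMost_Suc_shift del: sum.atMost_Suc)
  also have "\<dots> = (\<Sum>m\<le>L. q ^ (m * (m + s)) * q ^ m * qbinom q L m * D (m + s))"
    by (simp add: qbinom_eq_0)
  also have "\<dots> = (\<Sum>m\<le>L. q ^ (m * (m + Suc s)) * qbinom q L m * D (m + Suc s) - f m)"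
  proof (rule sum.cong)
    fix m
    show "q ^ (m * (m + s)) * q ^ m * qbinom q L m * D (m + s)
        = q ^ (m * (m + Suc s)) * qbinom q L m * D (m + Suc s) - f m"
      unfolding f_def D [of "m + s"]
      by (simp add: algebra_simps power_add)
  qed simp
  also have "(\<Sum>m\<le>L. f m) + \<dots> = D (L + Suc s)"
    by (simp only: sum_subtractf Suc.IH) simp
  finally show ?case by simp
qed

subsection \<open>Slater's identity modulo $q^{M+1}$\<close>

definition invP :: "nat \<Rightarrow> nat \<Rightarrow> 'a::field fps" where
  "invP d n = inverse (qpoch (fps_X ^ d) (fps_X ^ d) n)"

lemma qpoch_nth_0: "0 < d \<Longrightarrow> fps_nth (qpoch (fps_X ^ d) (fps_X ^ d :: 'a::field fps) n) 0 = 1"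
  by (induction n) (auto simp: qpoch_Suc)

lemma qpoch_invP [simp]: "0 < d \<Longrightarrow> qpoch (fps_X ^ d) (fps_X ^ d) n * invP d n = 1"
  by (simp add: invP_def inverse_mult_eq_1' qpoch_nth_0)

lemma invP_Suc: "0 < d \<Longrightarrow> invP d n = (1 - (fps_X ^ d) ^ Suc n) * invP d (Suc n)"
  by (simp add: invP_def qpoch_Suc fps_inverse_mult inverse_mult_eq_1' mult.left_commute)

lemma qbinom_invP:
  assumes "0 < d"
  shows "qbinom (fps_X ^ d) (k + m) k * invP d (k + m) = invP d k * invP d m"
proof -
  let ?P = "qpoch (fps_X ^ d) (fps_X ^ d) :: nat \<Rightarrow> 'a fps"
  let ?b = "qbinom (fps_X ^ d) (k + m) k :: 'a fps"
  have "?b * invP d (k + m)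
      = ?b * invP d (k + m) * ((?P k * invP d k) * (?P m * invP d m))"
    using assms by simp
  also have "\<dots> = (?b * (?P k * ?P m)) * invP d (k + m) * (invP d k * invP d m)"
    by (simp only: mult_ac)
  also have "\<dots> = invP d k * invP d m"
    using assms by (simp add: qbinom_qpoch)
  finally show ?thesis .
qed

lemma qbinom_eq_invP:
  assumes "0 < d"
  shows "qbinom (fps_X ^ d) (k + m) k
    = qpoch (fps_X ^ d) (fps_X ^ d) (k + m) * (invP d k * invP d m :: 'a::field fps)"
proof -
  let ?P = "qpoch (fps_X ^ d) (fps_X ^ d) (k + m) :: 'a fps"
  let ?b = "qbinom (fps_X ^ d) (k + m) k :: 'a fps"
  have "?b = ?b * (?P * invP d (k + m))"
    using assms by simp
  also have "\<dots> = ?P * (?b * invP d (k + m))"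
    by (simp only: mult_ac)
  finally show ?thesis
    by (simp only: qbinom_invP [OF assms])
qed

definition slater_term :: "nat \<Rightarrow> 'a::field fps" where
  "slater_term n = fps_X ^ n\<^sup>2 * (\<Prod>i<n. (1 + fps_X ^ i) * (1 + fps_X ^ Suc i)) * invP 1 (2 * n)"

definition slater_theta :: "nat \<Rightarrow> 'a::field fps" where
  "slater_theta s = fps_X ^ s\<^sup>2 * theta_term 1 fps_X s"

text \<open>This is the finite form of Bailey's lemma at $a = 1$, applied to the Bailey pair
  which the finite Jacobi triple product supplies.\<close>

lemma finite_Slater:
  "(\<Sum>n\<le>M. slater_term n * invP 1 (M - n))
     = (\<Sum>s\<le>M. slater_theta s * (invP 1 (M - s) * invP 1 (M + s)) :: 'a::field fps)"
proof -
  define X where "X = (fps_X :: 'a fps)"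
  define D where "D = (invP 1 :: nat \<Rightarrow> 'a fps)"
  define a where "a = theta_term 1 X"
  have binom: "qbinom X (k + m) k * D (k + m) = D k * D m" for k m
    using qbinom_invP [of 1 k m] by (simp add: X_def D_def)
  have D_Suc: "D m = (1 - X ^ Suc m) * D (Suc m)" for m
    using invP_Suc [of 1 m] by (simp add: X_def D_def)
  have D_eq: "D k * D m = qbinom X (k + m) k * D (k + m)" for k m
    using binom by simp
  have term_eq: "slater_term n = X ^ n\<^sup>2 * (\<Prod>i<n. (1 + X ^ i) * (1 + X ^ Suc i)) * D (2 * n)" for n
    by (simp only: slater_term_def X_def D_def)
  \<comment> \<open>Dividing the Gaussian binomial by (q;q)_(2n) leaves 1/((q;q)_(n+s) (q;q)_(n-s)),
    the kernel of a Bailey pair at a = 1.\<close>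
  have expand: "slater_term n * D (M - n) = (\<Sum>s\<le>n. X ^ n\<^sup>2 * a s * (D (n + s) * D (n - s) * D (M - n)))"
    for n
  proof -
    have "(\<Prod>i<n. (1 + X ^ i) * (1 + X ^ Suc i)) = (\<Sum>s\<le>n. a s * qbinom X (2 * n) (n + s))"
      using finite_Jacobi_triple_product [of 1 X n] by (simp add: a_def)
    then have "slater_term n * D (M - n)
        = (\<Sum>s\<le>n. X ^ n\<^sup>2 * a s * ((qbinom X (2 * n) (n + s) * D (2 * n)) * D (M - n)))"
      by (simp only: term_eq sum_distrib_left sum_distrib_right mult_ac)
    also have "\<dots> = (\<Sum>s\<le>n. X ^ n\<^sup>2 * a s * (D (n + s) * D (n - s) * D (M - n)))"
    proof (rule sum.cong)
      fix s assume "s \<in> {..n}"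
      then show "X ^ n\<^sup>2 * a s * ((qbinom X (2 * n) (n + s) * D (2 * n)) * D (M - n))
          = X ^ n\<^sup>2 * a s * (D (n + s) * D (n - s) * D (M - n))"
        using binom [of "n + s" "n - s"] by (simp add: mult_2)
    qed simp
    finally show ?thesis .
  qed
  \<comment> \<open>With n = m + s and M = L + s the exponent is n^2 = s^2 + m (m + 2s), and
    1/((q;q)_m (q;q)_(L-m)) is a Gaussian binomial over (q;q)_L. This is q-Vandermonde with 2s in
    the place of s.\<close>
  have inner: "(\<Sum>n=s..M. X ^ n\<^sup>2 * a s * (D (n + s) * D (n - s) * D (M - n)))
      = X ^ s\<^sup>2 * a s * (D (M - s) * D (M + s))" if "s \<le> M" for s
  proof -
    obtain L where M: "M = L + s"
      using \<open>s \<le> M\<close> by (metis le_iff_add add.commute)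
    have "(\<Sum>n=s..M. X ^ n\<^sup>2 * a s * (D (n + s) * D (n - s) * D (M - n)))
        = (\<Sum>m\<le>L. X ^ (m + s)\<^sup>2 * a s * (D (m + s + s) * D m * D (L - m)))"
      by (rule sum.reindex_bij_witness [of _ "\<lambda>m. m + s" "\<lambda>n. n - s"]) (auto simp: M)
    also have "\<dots> = (\<Sum>m\<le>L. X ^ s\<^sup>2 * a s * D L * (X ^ (m * (m + 2 * s)) * qbinom X L m * D (m + 2 * s)))"
    proof (rule sum.cong)
      fix m assume "m \<in> {..L}"
      then have "D m * D (L - m) = qbinom X L m * D L"
        using D_eq [of m "L - m"] by simp
      moreover have "(m + s)\<^sup>2 = s\<^sup>2 + m * (m + 2 * s)"
        by (simp add: power2_eq_square algebra_simps)
      moreover have "m + s + s = m + 2 * s"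
        by simp
      ultimately show "X ^ (m + s)\<^sup>2 * a s * (D (m + s + s) * D m * D (L - m))
          = X ^ s\<^sup>2 * a s * D L * (X ^ (m * (m + 2 * s)) * qbinom X L m * D (m + 2 * s))"
        by (simp only: power_add mult.assoc) (simp only: mult_ac)
    qed simp
    also have "\<dots> = X ^ s\<^sup>2 * a s * D L * D (L + 2 * s)"
      by (simp only: sum_distrib_left [symmetric] q_Vandermonde [OF D_Suc])
    finally show ?thesis
      by (simp add: M mult_2 mult.assoc add.assoc)
  qed
  have "(\<Sum>n\<le>M. slater_term n * D (M - n))
      = (\<Sum>n\<in>{..M}. \<Sum>s | s \<in> {..M} \<and> s \<le> n. X ^ n\<^sup>2 * a s * (D (n + s) * D (n - s) * D (M - n)))"
    unfolding expand by (intro sum.cong) auto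
  also have "\<dots> = (\<Sum>s\<in>{..M}. \<Sum>n | n \<in> {..M} \<and> s \<le> n. X ^ n\<^sup>2 * a s * (D (n + s) * D (n - s) * D (M - n)))"
    by (rule sum.swap_restrict) auto
  also have "\<dots> = (\<Sum>s\<le>M. \<Sum>n=s..M. X ^ n\<^sup>2 * a s * (D (n + s) * D (n - s) * D (M - n)))"
    by (intro sum.cong) auto
  also have "\<dots> = (\<Sum>s\<le>M. slater_theta s * (D (M - s) * D (M + s)))"
    using inner by (intro sum.cong) (auto simp: slater_theta_def X_def a_def)
  finally show ?thesis
    by (simp add: D_def)
qed

section \<open>Congruences modulo powers of q\<close>

lemma qpoch_cong: "k \<le> l \<Longrightarrow> q ^ Suc k dvd qpoch q q l - qpoch q q k"
proof (induction l rule: dec_induct)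
  case (step l)
  have "q ^ Suc k dvd q ^ Suc l"
    using step.hyps by (intro le_imp_power_dvd) simp
  then have "q ^ Suc k dvd qpoch q q l * q ^ Suc l"
    by (rule dvd_mult)
  moreover have "qpoch q q (Suc l) - qpoch q q k
      = (qpoch q q l - qpoch q q k) - qpoch q q l * q ^ Suc l"
    by (simp add: qpoch_Suc algebra_simps)
  ultimately show ?case
    using step.IH by (metis dvd_diff)
qed simp

text \<open>The congruence first holds modulo q^(d(k+1)); it is weakened to q^(k+1) so that the
  bases q and q^3 share one modulus.\<close>

lemma invP_cong:
  assumes "0 < d" "k \<le> l"
  shows "fps_X ^ Suc k dvd invP d l - (invP d k :: 'a::field fps)"
proof -
  let ?P = "qpoch (fps_X ^ d) (fps_X ^ d) :: nat \<Rightarrow> 'a fps"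
  have "invP d l - invP d k = invP d l * (?P k * invP d k) - invP d k * (?P l * invP d l)"
    using assms(1) by simp
  also have "\<dots> = - (invP d k * invP d l) * (?P l - ?P k)"
    by (simp add: algebra_simps)
  finally have "(fps_X ^ d) ^ Suc k dvd invP d l - (invP d k :: 'a fps)"
    using qpoch_cong [OF assms(2), of "fps_X ^ d :: 'a fps"] by (metis dvd_mult)
  moreover have "fps_X ^ Suc k dvd (fps_X ^ d) ^ Suc k"
    by (intro dvd_power_same dvd_power) (use assms(1) in simp)
  ultimately show ?thesis
    using dvd_trans by blast
qed

lemma dvd_diff_mult:
  fixes x :: "'a::comm_ring_1"
  assumes "x dvd a - b" "x dvd c - d"
  shows "x dvd a * c - b * d"
proof -
  have "a * c - b * d = (a - b) * c + b * (c - d)"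
    by (simp add: algebra_simps)
  then show ?thesis
    using assms by simp
qed

lemma dvd_diff_trans:
  fixes x :: "'a::comm_ring_1"
  assumes "x dvd a - b" "x dvd b - c"
  shows "x dvd a - c"
  using dvd_add [OF assms] by simp

text \<open>\<open>invP d (M - s)\<close> agrees with \<open>invP d M\<close> only modulo q^(M-s+1);
  the divisibility of \<open>b s\<close> by q^s supplies the missing s powers.\<close>

lemma sum_invP_cong:
  fixes b :: "nat \<Rightarrow> 'a::field fps"
  assumes "0 < d" and b: "\<And>s. fps_X ^ s dvd b s"
  shows "fps_X ^ Suc M dvd (\<Sum>s\<le>M. b s * (invP d (M - s) * invP d (M + s)))
    - (\<Sum>s\<le>M. b s) * (invP d M * invP d M)"
proof -
  have "fps_X ^ Suc M dvd b s * (invP d (M - s) * invP d (M + s)) - b s * (invP d M * invP d M)"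
    if "s \<le> M" for s
  proof -
    have *: "fps_X ^ Suc (M - s) dvd invP d l - (invP d m :: 'a fps)" if "M - s \<le> l" "M - s \<le> m" for l m
      using dvd_diff [OF invP_cong [OF assms(1) that(1)] invP_cong [OF assms(1) that(2)]] by simp
    have "fps_X ^ s * fps_X ^ Suc (M - s)
        dvd b s * (invP d (M - s) * invP d (M + s) - invP d M * invP d M)"
      by (intro mult_dvd_mono b dvd_diff_mult *) auto
    then show ?thesis
      using that by (simp add: right_diff_distrib flip: power_add power_Suc)
  qed
  then have "fps_X ^ Suc M dvd (\<Sum>s\<le>M. b s * (invP d (M - s) * invP d (M + s)) - b s * (invP d M * invP d M))"
    by (intro dvd_sum) auto
  then show ?thesis
    by (simp only: sum_subtractf sum_distrib_right)
qed

text \<open>The change of base: the exponent identity turns q into q^3, and q^s (1 + q^s) = q^s +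
  (q^2)^s exhibits z = q and u = q^2, with z u = q^3.\<close>

lemma slater_theta_eq: "slater_theta s = (theta_term fps_X (fps_X\<^sup>2) s :: 'a::field fps)"
proof (cases s)
  case (Suc t)
  have "s\<^sup>2 + (s choose 2) = 3 * (s choose 2) + s"
  proof (induction s)
    case (Suc n)
    have "Suc n choose 2 = n + (n choose 2)"
      by (simp add: numeral_2_eq_2)
    then show ?case
      using Suc.IH by (simp add: power2_eq_square del: binomial_Suc_Suc)
  qed simp
  then have "fps_X ^ (s\<^sup>2 + (s choose 2)) = (fps_X :: 'a fps) ^ (3 * (s choose 2) + s)"
    by (simp only:)
  then have "fps_X ^ s\<^sup>2 * fps_X ^ (s choose 2) = (fps_X ^ 3) ^ (s choose 2) * (fps_X ^ s :: 'a fps)"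
    by (simp only: power_add power_mult)
  moreover have "slater_theta s = fps_X ^ s\<^sup>2 * fps_X ^ (s choose 2) * (1 + fps_X ^ s :: 'a fps)"
    using Suc by (simp add: slater_theta_def theta_term_def mult.assoc del: power_Suc)
  ultimately have "slater_theta s = (fps_X ^ 3) ^ (s choose 2) * (fps_X ^ s * (1 + fps_X ^ s) :: 'a fps)"
    by (simp only: mult.assoc)
  also have "fps_X ^ s * (1 + fps_X ^ s) = fps_X ^ s + (fps_X\<^sup>2 :: 'a fps) ^ s"
    by (simp only: distrib_left mult_1_right power2_eq_square power_mult_distrib)
  also have "fps_X ^ 3 = (fps_X * fps_X\<^sup>2 :: 'a fps)"
    by (simp add: power2_eq_square power3_eq_cube mult.assoc)
  finally show ?thesis
    using Suc by (simp only: theta_term_def) simp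
qed (simp add: slater_theta_def theta_term_def)

lemma X_dvd_slater_theta: "fps_X ^ s dvd slater_theta s"
  unfolding slater_theta_def
  by (intro dvd_mult2 le_imp_power_dvd) (simp add: power2_eq_square)

section \<open>The product side and the comparison\<close>

definition regular3 :: "nat \<Rightarrow> 'a::field fps" where
  "regular3 M = (\<Prod>i<M. (1 + fps_X ^ (3 * i + 1)) * (1 + fps_X ^ (3 * i + 2))
     * inverse (1 - fps_X ^ (3 * i + 1)) * inverse (1 - fps_X ^ (3 * i + 2)))"

text \<open>The factors of (q;q)_(3M) come in blocks of three; the product in base q^3 cancels those
  at multiples of 3.\<close>

lemma regular3_eq:
  "regular3 M = (\<Prod>i<M. (1 + fps_X ^ (3 * i + 1)) * (1 + fps_X ^ (3 * i + 2)))
     * (qpoch (fps_X ^ 3) (fps_X ^ 3) M * invP 1 (3 * M))"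
proof (induction M)
  case 0
  show ?case by (simp add: regular3_def invP_def)
next
  case (Suc M)
  have u: "(1 - fps_X ^ 3 * (fps_X ^ 3) ^ M) * inverse (1 - fps_X ^ (3 * M + 3)) = (1 :: 'a fps)"
    by (simp add: inverse_mult_eq_1' flip: power_mult power_add add.commute)
  have "invP 1 (3 * Suc M) = (invP 1 (3 * M) :: 'a fps)
      * inverse (1 - fps_X ^ (3 * M + 1)) * inverse (1 - fps_X ^ (3 * M + 2)) * inverse (1 - fps_X ^ (3 * M + 3))"
    by (simp add: invP_def qpoch_Suc fps_inverse_mult numeral_3_eq_3 mult.assoc)
  then have "qpoch (fps_X ^ 3) (fps_X ^ 3) (Suc M) * (invP 1 (3 * Suc M) :: 'a fps)
      = qpoch (fps_X ^ 3) (fps_X ^ 3) M * invP 1 (3 * M)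
        * inverse (1 - fps_X ^ (3 * M + 1)) * inverse (1 - fps_X ^ (3 * M + 2))
        * ((1 - fps_X ^ 3 * (fps_X ^ 3) ^ M) * inverse (1 - fps_X ^ (3 * M + 3)))"
    by (simp only: qpoch_Suc mult_ac)
  also note u
  finally show ?case
    using Suc.IH by (simp only: regular3_def prod.lessThan_Suc mult_1_right mult_1_left mult_ac)
qed

text \<open>Modulo q^(M+1), the finite Bailey identity gives S = B/(q;q)_M and the triple product
  with z = q, u = q^2 gives G = B/(q^3;q^3)_M, where B is the truncated theta series. Eliminating B
  leaves the product.\<close>

theorem Slater_cong:
  "fps_X ^ Suc M dvd (\<Sum>n\<le>M. slater_term n) - (regular3 M :: 'a::field fps)"
proof -
  let ?m = "fps_X ^ Suc M :: 'a fps"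
  let ?P = "qpoch (fps_X ^ 1) (fps_X ^ 1) M :: 'a fps"
  let ?P3 = "qpoch (fps_X ^ 3) (fps_X ^ 3) :: nat \<Rightarrow> 'a fps"
  define D where "D = (invP 1 M :: 'a fps)"
  define E where "E = (invP 3 M :: 'a fps)"
  define S where "S = (\<Sum>n\<le>M. slater_term n :: 'a fps)"
  define B where "B = (\<Sum>s\<le>M. slater_theta s :: 'a fps)"
  define G where "G = (\<Prod>i<M. (1 + fps_X ^ (3 * i + 1)) * (1 + fps_X ^ (3 * i + 2)) :: 'a fps)"
  have PD: "?P * D = 1" and PE: "?P3 M * E = 1"
    by (simp_all only: D_def E_def qpoch_invP zero_less_one zero_less_numeral)
  have 1: "?m dvd (\<Sum>n\<le>M. slater_term n * invP 1 (M - n)) - S * D"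
  proof -
    have "?m dvd slater_term n * invP 1 (M - n) - slater_term n * D" if "n \<le> M" for n
    proof -
      have "fps_X ^ n dvd (slater_term n :: 'a fps)"
        unfolding slater_term_def
        by (intro dvd_mult2 le_imp_power_dvd) (simp add: power2_eq_square)
      then have "fps_X ^ n * fps_X ^ Suc (M - n) dvd slater_term n * (D - invP 1 (M - n))"
        unfolding D_def by (intro mult_dvd_mono invP_cong) auto
      then have "?m dvd slater_term n * (D - invP 1 (M - n))"
        using that by (simp flip: power_add power_Suc)
      then show ?thesis
        by (simp only: right_diff_distrib dvd_diff_commute)
    qed
    then have "?m dvd (\<Sum>n\<le>M. slater_term n * invP 1 (M - n) - slater_term n * D)"
      by (intro dvd_sum) auto
    then show ?thesis
      by (simp only: sum_subtractf sum_distrib_right S_def)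
  qed
  have 2: "?m dvd (\<Sum>n\<le>M. slater_term n * invP 1 (M - n)) - B * (D * D)"
    unfolding finite_Slater B_def D_def
    by (rule sum_invP_cong) (simp_all add: X_dvd_slater_theta)
  from 2 [THEN iffD1 [OF dvd_diff_commute]] 1 have "?m dvd B * (D * D) - S * D"
    by (rule dvd_diff_trans)
  \<comment> \<open>Both sides carry one factor 1/(q;q)_M too many; multiplying by the product
    \<open>?P\<close> removes it.\<close>
  then have "?m dvd (B * (D * D) - S * D) * ?P"
    by (rule dvd_mult2)
  also have "(B * (D * D) - S * D) * ?P = (B * D - S) * (?P * D)"
    by (simp only: left_diff_distrib right_diff_distrib mult_ac)
  finally have S: "?m dvd S - B * D"
    unfolding PD mult_1_right by (rule iffD1 [OF dvd_diff_commute])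
  have X3: "fps_X * fps_X\<^sup>2 = (fps_X ^ 3 :: 'a fps)"
    by (simp add: power2_eq_square power3_eq_cube mult.assoc)
  have "1 + fps_X ^ (3 * i + 1) = 1 + fps_X * (fps_X ^ 3 :: 'a fps) ^ i"
    "1 + fps_X ^ (3 * i + 2) = 1 + fps_X\<^sup>2 * (fps_X ^ 3 :: 'a fps) ^ i" for i
    by (simp_all only: power_add power_mult power_one_right mult.commute [of "(fps_X ^ 3) ^ i"])
  then have "G = (\<Sum>s\<le>M. slater_theta s * qbinom (fps_X ^ 3) (2 * M) (M + s))"
    using finite_Jacobi_triple_product [of "fps_X :: 'a fps" "fps_X\<^sup>2" M]
    by (simp only: G_def X3 slater_theta_eq)
  also have "\<dots> = (\<Sum>s\<le>M. slater_theta s * (?P3 (2 * M) * (invP 3 (M - s) * invP 3 (M + s))))"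
  proof (rule sum.cong)
    fix s assume "s \<in> {..M}"
    then have M: "2 * M = (M + s) + (M - s)"
      by simp
    have "qbinom (fps_X ^ 3) (2 * M) (M + s) = ?P3 (2 * M) * (invP 3 (M + s) * invP 3 (M - s))"
      unfolding M by (rule qbinom_eq_invP) simp
    then show "slater_theta s * qbinom (fps_X ^ 3) (2 * M) (M + s)
        = slater_theta s * (?P3 (2 * M) * (invP 3 (M - s) * invP 3 (M + s)))"
      by (simp only: mult_ac)
  qed simp
  also have "\<dots> = ?P3 (2 * M) * (\<Sum>s\<le>M. slater_theta s * (invP 3 (M - s) * invP 3 (M + s)))"
    by (simp add: sum_distrib_left mult_ac)
  finally have G: "G = ?P3 (2 * M) * (\<Sum>s\<le>M. slater_theta s * (invP 3 (M - s) * invP 3 (M + s)))" .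
  have "?m dvd ?P3 (2 * M) - ?P3 M"
  proof -
    have "?m dvd (fps_X ^ 3) ^ Suc M"
      by (intro dvd_power_same dvd_power) simp
    then show ?thesis
      by (rule dvd_trans) (simp only: qpoch_cong)
  qed
  moreover have "?m dvd (\<Sum>s\<le>M. slater_theta s * (invP 3 (M - s) * invP 3 (M + s))) - B * (E * E)"
    unfolding B_def E_def by (rule sum_invP_cong) (simp_all add: X_dvd_slater_theta)
  ultimately have "?m dvd G - ?P3 M * (B * (E * E))"
    unfolding G by (rule dvd_diff_mult)
  also have "?P3 M * (B * (E * E)) = B * E * (?P3 M * E)"
    by (simp only: mult_ac)
  also have "\<dots> = B * E"
    by (simp only: PE mult_1_right)
  finally have "?m dvd (G - B * E) * ?P3 M"
    by (rule dvd_mult2)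
  also have "(G - B * E) * ?P3 M = G * ?P3 M - B * (?P3 M * E)"
    by (simp only: left_diff_distrib right_diff_distrib mult_ac)
  finally have "?m dvd B - G * ?P3 M"
    unfolding PE mult_1_right by (rule iffD1 [OF dvd_diff_commute])
  \<comment> \<open>\<open>regular3_eq\<close> groups the exponents 1 to 3M, so \<open>D\<close> is
    replaced by the inverse with 3M factors.\<close>
  moreover have "?m dvd D - invP 1 (3 * M)"
    unfolding D_def by (rule iffD1 [OF dvd_diff_commute], rule invP_cong) simp_all
  ultimately have "?m dvd B * D - G * ?P3 M * invP 1 (3 * M)"
    by (rule dvd_diff_mult)
  with S have "?m dvd S - G * ?P3 M * invP 1 (3 * M)"
    by (rule dvd_diff_trans)
  then show ?thesis
    by (simp only: regular3_eq S_def G_def mult.assoc)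
qed

subsection \<open>Generating functions of weighted partitions\<close>

definition bounded_partitions :: "nat \<Rightarrow> nat \<Rightarrow> nat list set" where
  "bounded_partitions K N = {p. is_partition p \<and> set p \<subseteq> {..K} \<and> psize p = N}"

lemma finite_bounded_partitions [simp]: "finite (bounded_partitions K N)"
  by (rule finite_subset [OF _ finite_partitions [of N]]) (auto simp: bounded_partitions_def)

lemma count_list_replicate: "count_list (replicate n x) y = (if x = y then n else 0)"
  by (induction n) auto

lemma partition_split_largest:
  assumes "is_partition p" "set p \<subseteq> {..Suc K}"
  shows "p = replicate (freq p (Suc K)) (Suc K) @ filter (\<lambda>i. i \<le> K) p"
  using assms
proof (induction p)
  case (Cons a p)
  have p: "is_partition p" "set p \<subseteq> {..Suc K}"
    using Cons.prems by (auto simp: is_partition_def)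
  show ?case
  proof (cases "a = Suc K")
    case True
    then show ?thesis
      using Cons.IH [OF p, symmetric] by simp
  next
    case False
    then have "\<forall>i\<in>set (a # p). i \<le> K"
      using Cons.prems by (auto simp: is_partition_def)
    then show ?thesis
      by (auto simp: count_list_0_iff)
  qed
qed simp

lemma is_partition_replicate_append:
  assumes "is_partition p" "set p \<subseteq> {..K}"
  shows "is_partition (replicate l (Suc K) @ p)"
proof (induction l)
  case (Suc l)
  have "i \<le> Suc K" if "i \<in> set (replicate l (Suc K) @ p)" for i
  proof (cases "i \<in> set p")
    case True
    then show ?thesis using assms(2) by fastforce
  qed (use that in simp)
  then show ?case
    using Suc.IH zero_less_Suc
    unfolding is_partition_def replicate_Suc append_Cons sorted_wrt.simps list.set by blast
qed (simp add: assms)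

section \<open>Generating series of one part size\<close>

lemma fps_nth_compose_X_power:
  fixes f :: "'a::comm_ring_1 fps"
  assumes "0 < k"
  shows "fps_nth (f oo fps_X ^ k) n = (if k dvd n then fps_nth f (n div k) else 0)"
proof -
  have "fps_nth (f oo fps_X ^ k) n = (\<Sum>i=0..n. if i * k = n then fps_nth f i else 0)"
    unfolding fps_compose_nth by (intro sum.cong) (auto simp: mult.commute simp flip: power_mult)
  also have "\<dots> = (\<Sum>i | i \<in> {0..n} \<and> i * k = n. fps_nth f i)"
    by (rule sum.inter_filter [symmetric]) simp
  also have "{i. i \<in> {0..n} \<and> i * k = n} = (if k dvd n then {n div k} else {})"
    using assms by (auto simp: dvd_def)
  finally show ?thesis by simp
qed

text \<open>Written as a composite so that a closed form found for q serves every part size;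
  rational coefficients make 1 - q^i invertible.\<close>

definition part_gf :: "(nat \<Rightarrow> int) \<Rightarrow> nat \<Rightarrow> rat fps" where
  "part_gf w i = Abs_fps (\<lambda>f. of_int (w f)) oo fps_X ^ i"

text \<open>All copies of the largest size are removed at once: a partition of N with parts at most
  K + 1 is a partition of some j with parts at most K together with (N - j)/(K + 1) copies of K + 1,
  and the Cauchy product sums over these pairs.\<close>

lemma prod_part_gf_nth:
  "fps_nth (\<Prod>i\<in>{1..K}. part_gf (w i) i) N
     = of_int (\<Sum>p\<in>bounded_partitions K N. \<Prod>i\<in>{1..K}. w i (freq p i))"
proof (induction K arbitrary: N)
  case 0
  have "bounded_partitions 0 N = (if N = 0 then {[]} else {})"
  proof -
    have "p = []" if "p \<in> bounded_partitions 0 N" for p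
      using that by (cases p) (auto simp: bounded_partitions_def is_partition_def)
    moreover have "[] \<in> bounded_partitions 0 N \<longleftrightarrow> N = 0"
      by (auto simp: bounded_partitions_def is_partition_def)
    ultimately show ?thesis
      by (auto split: if_splits)
  qed
  then show ?case by simp
next
  case (Suc K)
  define W where "W p = (\<Prod>i\<in>{1..K}. w i (freq p i))" for p
  define J where "J = {j. j \<le> N \<and> Suc K dvd N - j}"
  have fin: "finite J" by (simp add: J_def)
  have "fps_nth (\<Prod>i\<in>{1..Suc K}. part_gf (w i) i) N
      = (\<Sum>j=0..N. of_int (\<Sum>p\<in>bounded_partitions K j. W p)
          * (if Suc K dvd N - j then of_int (w (Suc K) ((N - j) div Suc K)) else 0))"
  proof -
    have "(\<Prod>i\<in>{1..Suc K}. part_gf (w i) i)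
        = (\<Prod>i\<in>{1..K}. part_gf (w i) i) * part_gf (w (Suc K)) (Suc K)"
      by simp
    moreover have "fps_nth (part_gf (w (Suc K)) (Suc K)) m
        = (if Suc K dvd m then of_int (w (Suc K) (m div Suc K)) else 0)" for m
      unfolding part_gf_def by (subst fps_nth_compose_X_power) auto
    ultimately show ?thesis
      by (simp only: fps_mult_nth Suc.IH W_def)
  qed
  also have "\<dots> = (\<Sum>j\<in>J. of_int (\<Sum>p\<in>bounded_partitions K j. W p)
          * of_int (w (Suc K) ((N - j) div Suc K)))"
    by (rule sum.mono_neutral_cong_right) (auto simp: J_def)
  also have "\<dots> = of_int (\<Sum>j\<in>J. \<Sum>p\<in>bounded_partitions K j. W p * w (Suc K) ((N - j) div Suc K))"
    by (simp add: sum_distrib_right)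
  also have "(\<Sum>j\<in>J. \<Sum>p\<in>bounded_partitions K j. W p * w (Suc K) ((N - j) div Suc K))
      = (\<Sum>(j, p)\<in>Sigma J (bounded_partitions K). W p * w (Suc K) ((N - j) div Suc K))"
    using fin by (intro sum.Sigma) auto
  also have "\<dots> = (\<Sum>p\<in>bounded_partitions (Suc K) N. \<Prod>i\<in>{1..Suc K}. w i (freq p i))"
  proof (rule sum.reindex_bij_witness [of _
        "\<lambda>p. (sum_list (filter (\<lambda>i. i \<le> K) p), filter (\<lambda>i. i \<le> K) p)"
        "\<lambda>(j, p). replicate ((N - j) div Suc K) (Suc K) @ p"])
    fix x assume "x \<in> Sigma J (bounded_partitions K)"
    then obtain j p where x: "x = (j, p)" and j: "j \<le> N" "Suc K dvd N - j"
      and p: "is_partition p" "set p \<subseteq> {..K}" "sum_list p = j"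
      by (auto simp: J_def bounded_partitions_def)
    define m where "m = (N - j) div Suc K"
    have m: "m * Suc K = N - j"
      using j by (simp add: m_def del: mult_Suc_right)
    have "filter (\<lambda>i. i \<le> K) p = p"
      using p by (auto simp: filter_id_conv)
    then show "(\<lambda>p. (sum_list (filter (\<lambda>i. i \<le> K) p), filter (\<lambda>i. i \<le> K) p))
        ((\<lambda>(j, p). replicate ((N - j) div Suc K) (Suc K) @ p) x) = x"
      using p by (simp add: x)
    have "is_partition (replicate m (Suc K) @ p)"
      using p by (simp only: is_partition_replicate_append)
    then show "(\<lambda>(j, p). replicate ((N - j) div Suc K) (Suc K) @ p) x \<in> bounded_partitions (Suc K) N"
      using p(2,3) m j(1) unfolding x bounded_partitions_def prod.case m_def [symmetric]
      by (simp add: sum_list_replicate set_replicate_conv_if le_SucI subset_iff del: mult_Suc_right)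
    have "freq p (Suc K) = 0"
      using p by (auto simp: count_list_0_iff)
    then have "(\<Prod>i\<in>{1..Suc K}. w i (freq (replicate m (Suc K) @ p) i)) = W p * w (Suc K) m"
      by (simp add: count_list_replicate W_def)
    then show "(\<Prod>i\<in>{1..Suc K}. w i (freq ((\<lambda>(j, p). replicate ((N - j) div Suc K) (Suc K) @ p) x) i))
        = (case x of (j, p) \<Rightarrow> W p * w (Suc K) ((N - j) div Suc K))"
      by (simp add: x m_def)
  next
    fix p assume "p \<in> bounded_partitions (Suc K) N"
    then have p: "is_partition p" "set p \<subseteq> {..Suc K}" "sum_list p = N"
      by (auto simp: bounded_partitions_def)
    define p' where "p' = filter (\<lambda>i. i \<le> K) p"
    define m where "m = freq p (Suc K)"
    have eq: "p = replicate m (Suc K) @ p'"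
      unfolding p'_def m_def by (rule partition_split_largest) (use p in auto)
    have "sum_list p = m * Suc K + sum_list p'"
      by (subst eq) (simp add: sum_list_replicate)
    then have N: "N - sum_list p' = m * Suc K" "sum_list p' \<le> N"
      using p(3) by simp_all
    show "(\<lambda>(j, p). replicate ((N - j) div Suc K) (Suc K) @ p)
        (sum_list (filter (\<lambda>i. i \<le> K) p), filter (\<lambda>i. i \<le> K) p) = p"
      unfolding p'_def [symmetric] prod.case N(1) using eq by (simp del: mult_Suc_right)
    have "is_partition p'"
      using p(1) by (auto simp: p'_def is_partition_def sorted_wrt_filter)
    then show "(sum_list (filter (\<lambda>i. i \<le> K) p), filter (\<lambda>i. i \<le> K) p) \<in> Sigma J (bounded_partitions K)"
      using N by (auto simp: J_def bounded_partitions_def p'_def simp del: mult_Suc_right)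
  qed
  finally show ?case .
qed

lemma Abs_fps_times_one_minus_X:
  "Abs_fps w * (1 - fps_X) = Abs_fps (\<lambda>n. w n - (if n = 0 then 0 else w (n - 1) :: 'a::comm_ring_1))"
  by (rule fps_ext) (simp add: right_diff_distrib)

lemma part_gf_eq:
  assumes "Abs_fps (\<lambda>f. of_int (w f)) * (1 - fps_X) ^ k = g" "0 < i"
  shows "part_gf w i = (g oo fps_X ^ i) * inverse (1 - fps_X ^ i) ^ k"
proof -
  have "part_gf w i * (1 - fps_X ^ i) ^ k = g oo fps_X ^ i"
    using assms(2) by (simp add: assms(1) [symmetric] part_gf_def fps_compose_mult_distrib
        fps_compose_sub_distrib flip: fps_compose_power)
  moreover have "(1 - fps_X ^ i) ^ k * inverse (1 - fps_X ^ i :: rat fps) ^ k = 1"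
    using assms(2) by (simp add: inverse_mult_eq_1' flip: power_mult_distrib)
  ultimately show ?thesis
    by (simp only: mult.assoc mult_1_right flip: \<open>part_gf w i * (1 - fps_X ^ i) ^ k = g oo fps_X ^ i\<close>)
qed

section \<open>T_n as a product over part sizes\<close>

definition geo :: "nat \<Rightarrow> 'a::field fps" where
  "geo i = inverse (1 - fps_X ^ i)"

lemma invP_eq_geo: "invP 1 n = (\<Prod>i<n. geo (Suc i))"
  by (induction n) (simp_all add: invP_def qpoch_Suc fps_inverse_mult geo_def)

lemma geo_double: "0 < i \<Longrightarrow> (1 + fps_X ^ i) * geo (2 * i) = (geo i :: 'a::field fps)"
proof -
  assume i: "0 < i"
  have "(1 - fps_X ^ (2 * i) :: 'a fps) = (1 + fps_X ^ i) * (1 - fps_X ^ i)"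
    by (simp add: algebra_simps mult_2 mult_2_right power_add)
  then have "(1 + fps_X ^ i) * geo (2 * i)
      = ((1 + fps_X ^ i) * inverse (1 + fps_X ^ i)) * (geo i :: 'a fps)"
    by (simp only: geo_def fps_inverse_mult mult.assoc)
  then show ?thesis
    using i by (simp add: inverse_mult_eq_1')
qed

text \<open>(q;q)_(2n) is split into odd and even exponents, and (-q;q)_n turns 1/(q^2;q^2)_n into
  1/(q;q)_n.\<close>

lemma slater_term_eq:
  "slater_term n = fps_X ^ n\<^sup>2 * (\<Prod>i<n. geo (2 * i + 1)) * (\<Prod>i<n. (1 + fps_X ^ i) * geo (Suc i) :: 'a::field fps)"
proof -
  have split: "invP 1 (2 * n) = (\<Prod>i<n. geo (2 * i + 1)) * (\<Prod>i<n. geo (2 * Suc i) :: 'a fps)"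
    unfolding invP_eq_geo by (induction n) (simp_all add: mult_ac)
  have "(\<Prod>i<n. (1 + fps_X ^ i) * (1 + fps_X ^ Suc i)) * (\<Prod>i<n. geo (2 * Suc i) :: 'a fps)
      = (\<Prod>i<n. (1 + fps_X ^ i) * ((1 + fps_X ^ Suc i) * geo (2 * Suc i)))"
    by (simp only: prod.distrib mult.assoc)
  also have "\<dots> = (\<Prod>i<n. (1 + fps_X ^ i) * geo (Suc i))"
    by (simp only: geo_double zero_less_Suc)
  finally have merge: "(\<Prod>i<n. (1 + fps_X ^ i) * (1 + fps_X ^ Suc i)) * (\<Prod>i<n. geo (2 * Suc i) :: 'a fps)
      = (\<Prod>i<n. (1 + fps_X ^ i) * geo (Suc i))" .
  have "x * a * (b * c) = x * b * (a * c)" for x a b c :: "'a fps"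
    by (simp only: mult_ac)
  then show ?thesis
    unfolding slater_term_def split merge [symmetric] .
qed

lemma prod_odd_even:
  fixes g :: "nat \<Rightarrow> 'a::comm_monoid_mult"
  assumes "0 < n"
  shows "(\<Prod>i\<in>{1..2 * n - 1}. g i) = (\<Prod>j<n. g (2 * j + 1)) * (\<Prod>j\<in>{1..n - 1}. g (2 * j))"
  using assms
proof (induction n rule: nat_induct_non_zero)
  case (Suc n)
  have "{1..2 * Suc n - 1} = insert (2 * n + 1) (insert (2 * n) {1..2 * n - 1})"
    using Suc.hyps by auto
  moreover have "{1..Suc n - 1} = insert n {1..n - 1}"
    using Suc.hyps by auto
  ultimately show ?case
    using Suc.hyps Suc.IH by (simp add: mult_ac)
qed simp

text \<open>The local factor at the part $i$ common to $R$ and $Q$: they differ only in which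
  powers of $q$ force parts to be present.\<close>

definition local_factor :: "nat \<Rightarrow> nat \<Rightarrow> 'a::field fps" where
  "local_factor n i = (if odd i then geo i else 1)
     * (if i < n then (1 + fps_X ^ i) * geo i else if i = n then 2 * geo n else 1)"

text \<open>The factor 1 + q^0 = 2 of (-1;q)_n is assigned to the part n; the other factors 1 + q^i
  are paired with 1/(1 - q^i).\<close>

lemma slater_term_eq_prod:
  assumes "0 < n"
  shows "slater_term n = (fps_X ^ n\<^sup>2 * (\<Prod>i\<in>{1..2 * n - 1}. local_factor n i) :: 'a::field fps)"
proof -
  let ?V = "\<lambda>i. if i < n then (1 + fps_X ^ i) * geo i else if i = n then 2 * geo n else (1 :: 'a fps)"
  obtain m where n: "n = Suc m"
    using assms by (metis not0_implies_Suc less_numeral_extra(3))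
  have "(\<Prod>i\<in>{1..2 * n - 1}. if odd i then geo i else 1) = (\<Prod>i<n. geo (2 * i + 1) :: 'a fps)"
    unfolding prod_odd_even [OF assms] by simp
  moreover have "(\<Prod>i\<in>{1..2 * n - 1}. ?V i) = (\<Prod>i<n. (1 + fps_X ^ i) * geo (Suc i))"
  proof -
    have "(\<Prod>i\<in>{1..2 * n - 1}. ?V i) = (\<Prod>i\<in>{1..n}. ?V i)"
      using assms by (intro prod.mono_neutral_right) auto
    also have "{1..n} = insert n {1..m}"
      by (auto simp: n)
    also have "(\<Prod>i\<in>insert n {1..m}. ?V i) = 2 * geo n * (\<Prod>i\<in>{1..m}. (1 + fps_X ^ i) * geo i)"
      by (simp add: n)
    also have "(\<Prod>i\<in>{1..m}. (1 + fps_X ^ i) * geo i)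
        = (\<Prod>i<m. (1 + fps_X ^ Suc i)) * (\<Prod>i<m. geo (Suc i) :: 'a fps)"
      by (induction m) (simp_all add: mult_ac)
    also have "2 * geo n * \<dots> = (\<Prod>i<n. 1 + fps_X ^ i) * (\<Prod>i<n. geo (Suc i))"
      unfolding n by (subst prod.lessThan_Suc_shift) (simp add: mult_ac)
    finally show ?thesis
      by (simp only: prod.distrib)
  qed
  ultimately show ?thesis
    by (simp only: slater_term_eq local_factor_def prod.distrib mult.assoc)
qed

lemma prod_even_powers:
  "0 < n \<Longrightarrow> (\<Prod>i\<in>{1..2 * n - 1}. if even i then fps_X ^ i else 1) * fps_X ^ n = (fps_X ^ n\<^sup>2 :: 'a::field fps)"
proof -
  assume n: "0 < n"
  have "(\<Prod>j\<in>{1..m}. fps_X ^ (2 * j)) = (fps_X ^ (m * Suc m) :: 'a fps)" for m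
    by (induction m) (simp_all add: algebra_simps flip: power_add)
  note this [of "n - 1"]
  moreover have "(n - 1) * Suc (n - 1) + n = n\<^sup>2"
    using n by (cases n) (simp_all add: power2_eq_square)
  ultimately show ?thesis
    unfolding prod_odd_even [OF n] by (simp flip: power_add)
qed

lemma prod_odd_powers:
  "0 < n \<Longrightarrow> (\<Prod>i\<in>{1..2 * n - 1}. if odd i then fps_X ^ i else 1) = (fps_X ^ n\<^sup>2 :: 'a::field fps)"
proof -
  assume n: "0 < n"
  have "(\<Prod>j<m. fps_X ^ (2 * j + 1)) = (fps_X ^ m\<^sup>2 :: 'a fps)" for m
    by (induction m) (simp_all add: power2_eq_square algebra_simps flip: power_add)
  then show ?thesis
    unfolding prod_odd_even [OF n] by simp
qed

section \<open>Local weights\<close>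

text \<open>Zero values encode the conditions: an even part below n must occur, one above n exactly
  once, and an even n at least twice, its 2 being the contribution of n to \<open>delta\<close>. For
  odd n the factor 2 f of \<open>mu\<close> itself vanishes if n is absent.\<close>

definition R_weight :: "nat \<Rightarrow> nat \<Rightarrow> nat \<Rightarrow> int" where
  "R_weight n i =
     (if odd i then
        (if i < n then (\<lambda>f. 2 * int f + 1) else if i = n then (\<lambda>f. 2 * int f) else (\<lambda>f. 1))
      else
        (if i < n then (\<lambda>f. of_bool (0 < f) * 2 ^ of_bool (1 < f))
         else if i = n then (\<lambda>f. of_bool (1 < f) * 2) else (\<lambda>f. of_bool (f = 1))))"

text \<open>At even i = n the weight is constantly 2: an absent n gives 1 + 1 in the bracket of
  \<open>eta\<close>, a present n gives 1 there and a factor 2 through \<open>nu_de\<close>.\<close>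

definition Q_weight :: "nat \<Rightarrow> nat \<Rightarrow> nat \<Rightarrow> int" where
  "Q_weight n i =
     (if odd i then
        (if i < n then (\<lambda>f. of_bool (0 < f) * (2 * int f - 1))
         else if i = n then (\<lambda>f. 2 * int f) else (\<lambda>f. of_bool (0 < f)))
      else
        (if i < n then (\<lambda>f. if f = 0 then 1 else 2)
         else if i = n then (\<lambda>f. 2) else (\<lambda>f. of_bool (f = 0))))"

definition C_weight :: "nat \<Rightarrow> nat \<Rightarrow> int" where
  "C_weight i = (if 3 dvd i then (\<lambda>f. of_bool (f = 0)) else (\<lambda>f. if f = 0 then 1 else 2))"

text \<open>Multiplying by 1 - q takes differences of the weight. The power needed to reach a
  polynomial is 2 for linear growth, 1 for an eventually constant weight and 0 for finite
  support.\<close>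

lemma part_gf_basic:
  assumes "0 < i"
  shows "part_gf (\<lambda>f. 2 * int f + 1) i = (1 + fps_X ^ i) * (geo i * geo i)" (is ?th1)
    and "part_gf (\<lambda>f. 2 * int f) i = 2 * fps_X ^ i * (geo i * geo i)" (is ?th2)
    and "part_gf (\<lambda>f. 1) i = geo i" (is ?th3)
    and "part_gf (\<lambda>f. of_bool (0 < f) * 2 ^ of_bool (1 < f)) i = fps_X ^ i * (1 + fps_X ^ i) * geo i" (is ?th4)
    and "part_gf (\<lambda>f. of_bool (1 < f) * 2) i = 2 * fps_X ^ i * fps_X ^ i * geo i" (is ?th5)
    and "part_gf (\<lambda>f. of_bool (f = 1)) i = fps_X ^ i" (is ?th6)
    and "part_gf (\<lambda>f. of_bool (0 < f) * (2 * int f - 1)) i = fps_X ^ i * (1 + fps_X ^ i) * (geo i * geo i)" (is ?th7)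
    and "part_gf (\<lambda>f. of_bool (0 < f)) i = fps_X ^ i * geo i" (is ?th8)
    and "part_gf (\<lambda>f. if f = 0 then 1 else 2) i = (1 + fps_X ^ i) * geo i" (is ?th9)
    and "part_gf (\<lambda>f. 2) i = 2 * geo i" (is ?th10)
    and "part_gf (\<lambda>f. of_bool (f = 0)) i = 1" (is ?th11)
proof -
  let ?A = "\<lambda>w. Abs_fps (\<lambda>f. rat_of_int (w f))"
  note gf = part_gf_eq [OF _ assms, unfolded geo_def [symmetric]]
  note diff = Abs_fps_times_one_minus_X power2_eq_square mult.assoc [symmetric] power_one_right
  have X: "fps_nth (fps_X ^ i :: rat fps) 0 = 0"
    using assms by simp
  have "fps_X oo fps_X ^ i = (fps_X ^ i :: rat fps)"
    using fps_X_power_compose [OF X, of 1] by simp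
  note comp = this fps_compose_add_distrib fps_compose_mult_distrib [OF X] power2_eq_square X
  have "?A (\<lambda>f. 2 * int f + 1) * (1 - fps_X) ^ 2 = 1 + fps_X"
    unfolding diff by (auto simp: fps_eq_iff fps_X_def)
  from gf [OF this] show ?th1
    by (simp add: comp)
  have "?A (\<lambda>f. 2 * int f) * (1 - fps_X) ^ 2 = 2 * fps_X"
    unfolding diff by (auto simp: fps_eq_iff fps_X_def numeral_fps_const)
  from gf [OF this] show ?th2
    by (simp add: comp)
  have "?A (\<lambda>f. 1) * (1 - fps_X) ^ 1 = 1"
    unfolding diff by (auto simp: fps_eq_iff)
  from gf [OF this] show ?th3
    by (simp add: comp)
  have "?A (\<lambda>f. of_bool (0 < f) * 2 ^ of_bool (1 < f)) * (1 - fps_X) ^ 1 = fps_X + fps_X ^ 2"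
    unfolding diff by (auto simp: fps_eq_iff simp flip: power2_eq_square)
  from gf [OF this] show ?th4
    by (simp add: comp distrib_left)
  have "?A (\<lambda>f. of_bool (1 < f) * 2) * (1 - fps_X) ^ 1 = 2 * fps_X ^ 2"
    unfolding diff by (auto simp: fps_eq_iff numeral_fps_const simp flip: power2_eq_square)
  from gf [OF this] show ?th5
    by (simp add: comp mult.assoc)
  have "?A (\<lambda>f. of_bool (f = 1)) * (1 - fps_X) ^ 0 = fps_X"
    by (auto simp: fps_eq_iff)
  from gf [OF this] show ?th6
    by (simp add: comp)
  have "?A (\<lambda>f. of_bool (0 < f) * (2 * int f - 1)) * (1 - fps_X) ^ 2 = fps_X + fps_X ^ 2"
    unfolding diff by (auto simp: fps_eq_iff of_nat_diff simp flip: power2_eq_square)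
  from gf [OF this] show ?th7
    by (simp add: comp distrib_left)
  have "?A (\<lambda>f. of_bool (0 < f)) * (1 - fps_X) ^ 1 = fps_X"
    unfolding diff by (auto simp: fps_eq_iff)
  from gf [OF this] show ?th8
    by (simp add: comp)
  have "?A (\<lambda>f. if f = 0 then 1 else 2) * (1 - fps_X) ^ 1 = 1 + fps_X"
    unfolding diff by (auto simp: fps_eq_iff fps_X_def)
  from gf [OF this] show ?th9
    by (simp add: comp)
  have "?A (\<lambda>f. 2) * (1 - fps_X) ^ 1 = 2"
    unfolding diff by (auto simp: fps_eq_iff numeral_fps_const)
  from gf [OF this] show ?th10
    by (simp add: comp)
  have "?A (\<lambda>f. of_bool (f = 0)) * (1 - fps_X) ^ 0 = 1"
    by (auto simp: fps_eq_iff)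
  from gf [OF this] show ?th11
    by (simp add: comp)
qed

text \<open>For even n the two extra powers meet at i = n and give q^(2n), in agreement with the two
  copies required there.\<close>

lemma R_weight_gf:
  assumes "0 < i"
  shows "part_gf (R_weight n i) i
    = (if even i then fps_X ^ i else 1) * (if i = n then fps_X ^ n else 1) * local_factor n i"
  using assms unfolding R_weight_def local_factor_def
  by (cases "odd i"; cases "i < n"; cases "i = n")
     (simp_all only: part_gf_basic simp_thms if_True if_False less_irrefl mult_1_left mult_1_right,
      simp_all only: mult_ac)

lemma Q_weight_gf:
  assumes "0 < i"
  shows "part_gf (Q_weight n i) i = (if odd i then fps_X ^ i else 1) * local_factor n i"
  using assms unfolding Q_weight_def local_factor_def
  by (cases "odd i"; cases "i < n"; cases "i = n")
     (simp_all only: part_gf_basic simp_thms if_True if_False less_irrefl mult_1_left mult_1_right,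
      simp_all only: mult_ac)

lemma C_weight_gf:
  assumes "0 < i"
  shows "part_gf (C_weight i) i = (if 3 dvd i then 1 else (1 + fps_X ^ i) * geo i)"
  unfolding C_weight_def using part_gf_basic [OF assms] by simp

lemma prod_R_weight_gf:
  assumes "0 < n"
  shows "(\<Prod>i\<in>{1..2 * n - 1}. part_gf (R_weight n i) i) = slater_term n"
proof -
  have "(\<Prod>i\<in>{1..2 * n - 1}. part_gf (R_weight n i) i)
      = (\<Prod>i\<in>{1..2 * n - 1}. if even i then fps_X ^ i else 1)
        * (\<Prod>i\<in>{1..2 * n - 1}. if i = n then fps_X ^ n else 1)
        * (\<Prod>i\<in>{1..2 * n - 1}. local_factor n i)"
    unfolding prod.distrib [symmetric] by (intro prod.cong R_weight_gf) auto
  also have "(\<Prod>i\<in>{1..2 * n - 1}. if i = n then fps_X ^ n else 1) = (fps_X ^ n :: rat fps)"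
    using assms by (subst prod.delta) auto
  finally show ?thesis
    by (simp only: prod_even_powers [OF assms] slater_term_eq_prod [OF assms])
qed

lemma prod_Q_weight_gf:
  assumes "0 < n"
  shows "(\<Prod>i\<in>{1..2 * n - 1}. part_gf (Q_weight n i) i) = slater_term n"
proof -
  have "(\<Prod>i\<in>{1..2 * n - 1}. part_gf (Q_weight n i) i)
      = (\<Prod>i\<in>{1..2 * n - 1}. if odd i then fps_X ^ i else 1)
        * (\<Prod>i\<in>{1..2 * n - 1}. local_factor n i)"
    unfolding prod.distrib [symmetric] by (intro prod.cong Q_weight_gf) auto
  then show ?thesis
    by (simp only: prod_odd_powers [OF assms] slater_term_eq_prod [OF assms])
qed

lemma prod_C_weight_gf: "(\<Prod>i\<in>{1..3 * M}. part_gf (C_weight i) i) = regular3 M"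
proof (induction M)
  case (Suc M)
  have "{1..3 * Suc M} = insert (3 * M + 3) (insert (3 * M + 2) (insert (3 * M + 1) {1..3 * M}))"
    by auto
  moreover have "\<not> 3 dvd 3 * M + 1" "\<not> 3 dvd 3 * M + 2" "3 dvd 3 * M + 3"
    by presburger+
  ultimately show ?case
    using Suc.IH by (simp add: C_weight_gf regular3_def geo_def mult_ac)
qed (simp add: regular3_def)

subsection \<open>Weights of partitions with a given index\<close>

lemma prod_odd_below:
  fixes a :: "nat \<Rightarrow> 'a::comm_monoid_mult"
  shows "(\<Prod>j<n. if 2 * j + 1 < n then a j else if 2 * j + 1 = n then b else 1)
    = (\<Prod>j | 2 * j + 1 < n. a j) * (if odd n then b else 1)"
proof -
  have "(\<Prod>j<n. if 2 * j + 1 < n then a j else if 2 * j + 1 = n then b else 1)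
      = (\<Prod>j<n. if 2 * j + 1 < n then a j else 1) * (\<Prod>j<n. if 2 * j + 1 = n then b else 1)"
    unfolding prod.distrib [symmetric] by (intro prod.cong) auto
  moreover have "(\<Prod>j<n. if 2 * j + 1 < n then a j else 1) = (\<Prod>j | 2 * j + 1 < n. a j)"
    by (rule prod.mono_neutral_cong_right) auto
  moreover have "(\<Prod>j<n. if 2 * j + 1 = n then b else 1) = (if odd n then b else 1)"
  proof (cases "odd n")
    case True
    then obtain k where n: "n = 2 * k + 1"
      by (elim oddE)
    then have "(\<Prod>j<n. if 2 * j + 1 = n then b else 1) = (\<Prod>j<n. if j = k then b else 1)"
      by (intro prod.cong) auto
    also have "\<dots> = b"
      using n by (subst prod.delta) auto
    finally show ?thesis using True by simp
  next
    case False
    then have "(\<Prod>j<n. if 2 * j + 1 = n then b else 1) = (\<Prod>j<n. 1)"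
      by (intro prod.cong) auto
    then show ?thesis using False by simp
  qed
  ultimately show ?thesis by simp
qed

lemma prod_if_two_power_card:
  "finite A \<Longrightarrow> (\<Prod>i\<in>A. if P i then 2 else 1) = (2 :: int) ^ card {i \<in> A. P i}"
  by (simp add: prod.If_cases Int_def)

lemma freq_pos_iff: "0 < freq p i \<longleftrightarrow> i \<in> set p"
  by (metis count_list_0_iff gr0I less_irrefl)

lemma R_n_eq: "R_index p n \<Longrightarrow> R_n p = n"
  unfolding R_n_def by (rule the_equality) (auto intro: R_index_unique)

text \<open>If n is not the index, some condition fails at one part size, whose weight is then zero;
  the bound on the parts is assumed and cannot be what fails.\<close>

lemma prod_R_weight:
  assumes "0 < n" and bound: "set p \<subseteq> {..2 * n - 1}"
  shows "(\<Prod>i\<in>{1..2 * n - 1}. R_weight n i (freq p i)) = (if R_index p n then mu p else 0)"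
proof (cases "R_index p n")
  case True
  have "(\<Prod>j\<in>{1..n - 1}. R_weight n (2 * j) (freq p (2 * j)))
      = (\<Prod>j\<in>{1..n - 1}. 2 ^ of_bool (1 < freq p (2 * j)))"
  proof (rule prod.cong)
    fix j assume j: "j \<in> {1..n - 1}"
    have pos: "0 < freq p (2 * j)"
    proof -
      have "0 < 2 * j \<and> even (2 * j) \<and> 2 * j \<le> 2 * n - 2"
        using j by auto
      then show ?thesis
        using True unfolding R_index_def freq_pos_iff by blast
    qed
    consider "2 * j < n" | "2 * j = n" | "n < 2 * j"
      by linarith
    then show "R_weight n (2 * j) (freq p (2 * j)) = 2 ^ of_bool (1 < freq p (2 * j))"
    proof cases
      case 1
      then show ?thesis
        using pos by (simp add: R_weight_def)
    next
      case 2
      then have "1 < freq p (2 * j)"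
        using True by (auto simp: R_index_def)
      then show ?thesis
        using 2 by (auto simp: R_weight_def)
    next
      case 3
      then have "freq p (2 * j) = 1"
        using True pos unfolding R_index_def by (metis One_nat_def Suc_leI dvd_triv_left le_antisym)
      then show ?thesis
        using 3 by (simp add: R_weight_def)
    qed
  qed simp
  also have "\<dots> = 2 ^ delta p"
    by (simp only: delta_def R_n_eq [OF True] power_sum)
  finally have even: "(\<Prod>j\<in>{1..n - 1}. R_weight n (2 * j) (freq p (2 * j))) = 2 ^ delta p" .
  have "(\<Prod>j<n. R_weight n (2 * j + 1) (freq p (2 * j + 1)))
      = (\<Prod>j<n. if 2 * j + 1 < n then 2 * int (freq p (2 * j + 1)) + 1
          else if 2 * j + 1 = n then 2 * int (freq p n) else 1)"
    by (intro prod.cong) (auto simp: R_weight_def)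
  also have "\<dots> = (\<Prod>j | 2 * j + 1 < n. 2 * int (freq p (2 * j + 1)) + 1)
      * (if odd n then 2 * int (freq p n) else 1)"
    by (rule prod_odd_below)
  finally show ?thesis
    unfolding prod_odd_even [OF assms(1)] even mu_def R_n_eq [OF True] Let_def
    using True by simp
next
  case False
  have "\<exists>i\<in>{1..2 * n - 1}. R_weight n i (freq p i) = 0"
  proof -
    consider i where "0 < i" "even i" "i \<le> 2 * n - 2" "i \<notin> set p"
      | "freq p n < 1 + of_bool (even n)"
      | i where "even i" "n < i" "1 < freq p i"
      using False bound \<open>0 < n\<close> unfolding R_index_def by (auto simp: not_le)
    then show ?thesis
    proof cases
      case (1 i)
      then have "R_weight n i (freq p i) = 0"
        by (simp add: R_weight_def)
      then show ?thesis
        using 1 by (intro bexI [of _ i]) auto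
    next
      case 2
      then have "R_weight n n (freq p n) = 0"
        by (cases "even n") (auto simp: R_weight_def)
      then show ?thesis
        using \<open>0 < n\<close> by (intro bexI [of _ n]) auto
    next
      case (3 i)
      then have "R_weight n i (freq p i) = 0"
        by (simp add: R_weight_def)
      \<comment> \<open>Membership places i within the range of the product.\<close>
      moreover have "i \<in> set p"
        using 3 freq_pos_iff [of p i] by linarith
      ultimately show ?thesis
        using 3 bound by (intro bexI [of _ i]) auto
    qed
  qed
  then show ?thesis
    using False by (auto intro: prod_zero)
qed

lemma prod_Q_weight:
  assumes "0 < n" and bound: "set p \<subseteq> {..2 * n - 1}" and part: "is_partition p"
  shows "(\<Prod>i\<in>{1..2 * n - 1}. Q_weight n i (freq p i)) = (if Q_index p n then eta p else 0)"
proof (cases "Q_index p n")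
  case True
  have Q_n: "Q_n p = n"
    using Q_index_Q_n [OF True] by simp
  have odds: "i \<in> set p" if "odd i" "i \<le> 2 * n - 1" for i
    using True that by (simp add: Q_index_def)
  have evens: "2 * j \<le> n" if "2 * j \<in> set p" for j
    using True that by (simp add: Q_index_def)
  \<comment> \<open>At 2 j = n the two factors multiply to 2 whether or not n occurs.\<close>
  have "(\<Prod>j\<in>{1..n - 1}. Q_weight n (2 * j) (freq p (2 * j)))
      = (\<Prod>j\<in>{1..n - 1}. if 2 * j \<in> set p then 2 else 1)
        * (\<Prod>j\<in>{1..n - 1}. if 2 * j = n then 1 + of_bool (freq p n = 0) else 1)"
    unfolding prod.distrib [symmetric]
    by (intro prod.cong) (auto simp: Q_weight_def count_list_0_iff dest!: evens)
  also have "(\<Prod>j\<in>{1..n - 1}. if 2 * j \<in> set p then 2 else 1) = (2 :: int) ^ nu_de p"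
  proof -
    \<comment> \<open>Halving lands in 1..n-1, since parts are positive and an even part at most 2n
      - 1 is at most 2n - 2.\<close>
    have "bij_betw (\<lambda>j. 2 * j) {j \<in> {1..n - 1}. 2 * j \<in> set p} {i \<in> set p. even i}"
    proof (rule bij_betwI[where g = "\<lambda>i. i div 2"])
      show "(\<lambda>i. i div 2) \<in> {i \<in> set p. even i} \<rightarrow> {j \<in> {1..n - 1}. 2 * j \<in> set p}"
      proof
        fix i assume "i \<in> {i \<in> set p. even i}"
        then have "even i" "i \<in> set p" "0 < i" "i \<le> 2 * n - 1"
          using part bound by (auto simp: is_partition_def)
        then show "i div 2 \<in> {j \<in> {1..n - 1}. 2 * j \<in> set p}"
          by (auto elim!: evenE)
      qed
    qed auto
    then show ?thesis
      unfolding prod_if_two_power_card [OF finite_atLeastAtMost] nu_de_def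
      by (simp add: bij_betw_same_card)
  qed
  also have "(\<Prod>j\<in>{1..n - 1}. if 2 * j = n then 1 + of_bool (freq p n = 0) else 1)
      = (if even n then 1 + of_bool (freq p n = 0) else (1 :: int))"
  proof (cases "even n")
    case True
    then obtain k where n: "n = 2 * k"
      by (elim evenE)
    then have "(\<Prod>j\<in>{1..n - 1}. if 2 * j = n then 1 + of_bool (freq p n = 0) else (1 :: int))
        = (\<Prod>j\<in>{1..n - 1}. if j = k then 1 + of_bool (freq p n = 0) else 1)"
      by (intro prod.cong) auto
    also have "\<dots> = 1 + of_bool (freq p n = 0)"
      using n \<open>0 < n\<close> by (subst prod.delta) auto
    finally show ?thesis using True by simp
  next
    case False
    then have "(\<Prod>j\<in>{1..n - 1}. if 2 * j = n then 1 + of_bool (freq p n = 0) else (1 :: int))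
        = (\<Prod>j\<in>{1..n - 1}. 1)"
      by (intro prod.cong) auto
    then show ?thesis using False by simp
  qed
  finally have even: "(\<Prod>j\<in>{1..n - 1}. Q_weight n (2 * j) (freq p (2 * j)))
      = 2 ^ nu_de p * (if even n then 1 + of_bool (freq p n = 0) else 1)" .
  have "(\<Prod>j<n. Q_weight n (2 * j + 1) (freq p (2 * j + 1)))
      = (\<Prod>j<n. if 2 * j + 1 < n then 2 * int (freq p (2 * j + 1)) - 1
          else if 2 * j + 1 = n then 2 * int (freq p n) else 1)"
  proof (rule prod.cong)
    fix j assume "j \<in> {..<n}"
    then have "0 < freq p (2 * j + 1)"
      unfolding freq_pos_iff by (intro odds) auto
    then show "Q_weight n (2 * j + 1) (freq p (2 * j + 1))
        = (if 2 * j + 1 < n then 2 * int (freq p (2 * j + 1)) - 1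
          else if 2 * j + 1 = n then 2 * int (freq p n) else 1)"
      by (auto simp: Q_weight_def)
  qed simp
  also have "\<dots> = (\<Prod>j | 2 * j + 1 < n. 2 * int (freq p (2 * j + 1)) - 1)
      * (if odd n then 2 * int (freq p n) else 1)"
    by (rule prod_odd_below)
  finally show ?thesis
    unfolding prod_odd_even [OF assms(1)] even eta_def Q_n Let_def
    using True by simp
next
  case False
  have "\<exists>i\<in>{1..2 * n - 1}. Q_weight n i (freq p i) = 0"
  proof (cases "\<exists>i. odd i \<and> i \<le> 2 * n - 1 \<and> i \<notin> set p")
    case True
    then obtain i where i: "odd i" "i \<le> 2 * n - 1" "i \<notin> set p"
      by blast
    then have "Q_weight n i (freq p i) = 0"
      by (simp add: Q_weight_def)
    moreover have "1 \<le> i"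
      using i(1) by (cases i) auto
    ultimately show ?thesis
      using i(2) by (intro bexI [of _ i]) auto
  next
    case odds: False
    \<comment> \<open>With every odd size present the largest part is 2n - 1, so only an even part
      above n can violate the index.\<close>
    then have "2 * n - 1 \<in> set p"
      using \<open>0 < n\<close> by auto
    moreover from this have "Max (set p) = 2 * n - 1"
      using bound by (intro Max_eqI) auto
    moreover from calculation have "p \<noteq> []"
      by auto
    ultimately obtain i where i: "even i" "i \<in> set p" "n < i"
      using False odds \<open>0 < n\<close> unfolding Q_index_def by (auto simp: not_le)
    then have "Q_weight n i (freq p i) = 0"
      by (simp add: Q_weight_def count_list_0_iff)
    then show ?thesis
      using i bound by (intro bexI [of _ i]) auto
  qed
  then show ?thesis
    using False by (auto intro: prod_zero)
qed

lemma prod_C_weight: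
  assumes "is_partition p" "set p \<subseteq> {..K}"
  shows "(\<Prod>i\<in>{1..K}. C_weight i (freq p i)) = (if \<forall>i\<in>set p. \<not> 3 dvd i then 2 ^ nu_d p else 0)"
proof (cases "\<forall>i\<in>set p. \<not> 3 dvd i")
  case True
  have p: "set p \<subseteq> {1..K}"
    using assms by (auto simp: is_partition_def Suc_le_eq)
  have "(\<Prod>i\<in>{1..K}. C_weight i (freq p i)) = (\<Prod>i\<in>{1..K}. if i \<in> set p then 2 else 1)"
    using True by (intro prod.cong) (auto simp: C_weight_def count_list_0_iff)
  also have "\<dots> = 2 ^ card {i \<in> {1..K}. i \<in> set p}"
    by (simp add: prod_if_two_power_card)
  also have "{i \<in> {1..K}. i \<in> set p} = set p"
    using p by auto
  finally show ?thesis
    using True by (simp add: nu_d_def)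
next
  case False
  then obtain i where i: "i \<in> set p" "3 dvd i"
    by blast
  then have "C_weight i (freq p i) = 0"
    by (simp add: C_weight_def count_list_0_iff)
  moreover have "i \<in> {1..K}"
    using assms i by (auto simp: is_partition_def Suc_le_eq)
  ultimately have "(\<Prod>i\<in>{1..K}. C_weight i (freq p i)) = 0"
    by (intro prod_zero) auto
  then show ?thesis
    by (simp only: if_not_P [OF False])
qed

section \<open>Summation over the index\<close>

lemma sum_slater_term_nth:
  "fps_nth (\<Sum>n\<le>N. slater_term n) N = fps_nth (regular3 N :: 'a::field fps) N"
proof -
  obtain f :: "'a fps" where "(\<Sum>n\<le>N. slater_term n) - regular3 N = fps_X ^ Suc N * f"
    using Slater_cong [of N] by (elim dvdE)
  then have "fps_nth ((\<Sum>n\<le>N. slater_term n) - (regular3 N :: 'a fps)) N = 0"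
    by (simp only: fps_X_power_mult_nth) simp
  then show ?thesis by simp
qed

text \<open>The argument common to R and Q: partitions of N split disjointly by an index between 1
  and N, and zero weights extend each piece to all partitions with parts at most 2n - 1, counted by
  T_n.\<close>

lemma sum_over_index:
  fixes idx :: "nat list \<Rightarrow> nat \<Rightarrow> bool" and wt :: "nat list \<Rightarrow> int"
  assumes "0 < N"
    and unique: "\<And>p m n. idx p m \<Longrightarrow> idx p n \<Longrightarrow> m = n"
    and bound: "\<And>p n. idx p n \<Longrightarrow> 0 < n \<and> n \<le> psize p \<and> set p \<subseteq> {..2 * n - 1}"
    and weight: "\<And>p n. 0 < n \<Longrightarrow> set p \<subseteq> {..2 * n - 1} \<Longrightarrow> is_partition p \<Longrightarrow>
      (\<Prod>i\<in>{1..2 * n - 1}. w n i (freq p i)) = (if idx p n then wt p else 0)"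
    and gf: "\<And>n. 0 < n \<Longrightarrow> (\<Prod>i\<in>{1..2 * n - 1}. part_gf (w n i) i) = slater_term n"
  shows "rat_of_int (\<Sum>p | (is_partition p \<and> (\<exists>n. idx p n)) \<and> psize p = N. wt p)
    = fps_nth (regular3 N) N"
proof -
  define A where "A n = {p \<in> bounded_partitions (2 * n - 1) N. idx p n}" for n
  have "{p. (is_partition p \<and> (\<exists>n. idx p n)) \<and> psize p = N} = (\<Union>n\<in>{1..N}. A n)"
    using bound by (fastforce simp: A_def bounded_partitions_def)
  moreover have "sum wt (\<Union>n\<in>{1..N}. A n) = (\<Sum>n\<in>{1..N}. sum wt (A n))"
    by (rule sum.UNION_disjoint) (auto simp: A_def dest: unique)
  moreover have "rat_of_int (sum wt (A n)) = fps_nth (slater_term n) N" if "0 < n" for n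
  proof -
    have "sum wt (A n) = (\<Sum>p\<in>bounded_partitions (2 * n - 1) N. if idx p n then wt p else 0)"
      unfolding A_def by (rule sum.inter_filter) simp
    also have "\<dots> = (\<Sum>p\<in>bounded_partitions (2 * n - 1) N. \<Prod>i\<in>{1..2 * n - 1}. w n i (freq p i))"
      using weight [OF that] by (intro sum.cong) (auto simp: bounded_partitions_def)
    finally show ?thesis
      by (simp only: prod_part_gf_nth [symmetric] gf [OF that])
  qed
  ultimately have "rat_of_int (\<Sum>p | (is_partition p \<and> (\<exists>n. idx p n)) \<and> psize p = N. wt p)
      = (\<Sum>n\<in>{1..N}. fps_nth (slater_term n) N)"
    by simp
  \<comment> \<open>T_0 = 1 has no coefficient at q^N for positive N, so it may be included.\<close>
  also have "\<dots> = (\<Sum>n\<le>N. fps_nth (slater_term n) N)"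
    using \<open>0 < N\<close> by (intro sum.mono_neutral_left) (auto simp: slater_term_def invP_def not_less_eq_eq)
  also have "\<dots> = fps_nth (regular3 N) N"
    by (simp add: sum_slater_term_nth [symmetric] fps_sum_nth)
  finally show ?thesis .
qed

text \<open>The part bound is 3N rather than N so that the product of local series is exactly
  \<open>regular3 N\<close>; positivity of N excludes the empty partition.\<close>

lemma sum_Ctilde:
  assumes "0 < N"
  shows "rat_of_int (\<Sum>p | p \<in> Ctilde \<and> psize p = N. 2 ^ nu_d p) = fps_nth (regular3 N) N"
proof -
  have "{p. p \<in> Ctilde \<and> psize p = N}
      = {p \<in> bounded_partitions (3 * N) N. \<forall>i\<in>set p. \<not> 3 dvd i}"
  proof -
    have "i \<le> 3 * N" if "i \<in> set p" "psize p = N" for i p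
      using member_le_sum_list [OF that(1)] that(2) by simp
    then show ?thesis
      using assms by (auto simp: Ctilde_def bounded_partitions_def)
  qed
  then have "(\<Sum>p | p \<in> Ctilde \<and> psize p = N. 2 ^ nu_d p)
      = (\<Sum>p\<in>bounded_partitions (3 * N) N. if \<forall>i\<in>set p. \<not> 3 dvd i then (2 :: int) ^ nu_d p else 0)"
    by (simp only: sum.inter_filter [OF finite_bounded_partitions])
  also have "\<dots> = (\<Sum>p\<in>bounded_partitions (3 * N) N. \<Prod>i\<in>{1..3 * N}. C_weight i (freq p i))"
    by (intro sum.cong refl prod_C_weight [symmetric]) (auto simp: bounded_partitions_def)
  finally show ?thesis
    by (simp only: prod_part_gf_nth [symmetric] prod_C_weight_gf)
qed

theorem theorem6p3:
  fixes N :: nat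
  assumes "0 < N"
  shows "(\<Sum>p | p \<in> Ctilde \<and> psize p = N. 2 ^ nu_d p) = (\<Sum>p | p \<in> R_set \<and> psize p = N. mu p)
       \<and> (\<Sum>p | p \<in> R_set \<and> psize p = N. mu p) = (\<Sum>p | p \<in> Q_set \<and> psize p = N. eta p)"
proof -
  have R: "rat_of_int (\<Sum>p | p \<in> R_set \<and> psize p = N. mu p) = fps_nth (regular3 N) N"
    unfolding R_set_def mem_Collect_eq
  proof (rule sum_over_index [OF assms, where w = R_weight])
    fix p n assume R: "R_index p n"
    then have "n \<in> set p"
      using freq_pos_iff [of p n] by (auto simp: R_index_def)
    then show "0 < n \<and> n \<le> psize p \<and> set p \<subseteq> {..2 * n - 1}"
      using R by (auto simp: R_index_def member_le_sum_list)
  next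
    show "m = n" if "R_index p m" "R_index p n" for p m n
      using that by (rule R_index_unique)
  qed (simp_all only: prod_R_weight prod_R_weight_gf)
  have Q: "rat_of_int (\<Sum>p | p \<in> Q_set \<and> psize p = N. eta p) = fps_nth (regular3 N) N"
    unfolding Q_set_def mem_Collect_eq
  proof (rule sum_over_index [OF assms, where w = Q_weight])
    fix p n assume Q: "Q_index p n"
    then have "2 * n - 1 \<in> set p" "0 < n"
      by (auto simp: Q_index_def)
    then have "n \<le> psize p"
      using member_le_sum_list [of "2 * n - 1" p] by linarith
    moreover have "set p \<subseteq> {..2 * n - 1}"
    proof
      fix i assume "i \<in> set p"
      then show "i \<in> {..2 * n - 1}"
        using Q Max_ge [of "set p" i] by (simp add: Q_index_def)
    qed
    ultimately show "0 < n \<and> n \<le> psize p \<and> set p \<subseteq> {..2 * n - 1}"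
      using \<open>0 < n\<close> by blast
  next
    show "m = n" if "Q_index p m" "Q_index p n" for p m n
      using that [THEN Q_index_Q_n] by simp
  qed (simp_all only: prod_Q_weight prod_Q_weight_gf)
  show ?thesis
    by (simp only: R Q sum_Ctilde [OF assms] simp_thms flip: of_int_eq_iff [where ?'a = rat])
qed

end
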